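(* For each $n\ge 1$ consider the $n$-server system described in the context, where the graph is resampled according to a Poisson process of rate $\mu_n>0$. Suppose that there exist constants $\lambda>0$ and $p(d)\in[0,1]$, $d\in\mathbb{N}$, such that $\lambda_n/n\to\lambda$ and $p_n(d)\to p(d)$ for all $d\in\mathbb{N}$ as $n\to\infty$; that $\lim_{n\to\infty}(d_n^-+1)/\mu_n=0$; and that $$\sum_{d=0}^\infty p(d)=1\qquad\text{and}\qquad\sum_{d=0}^\infty d\,p(d)<\infty.$$ In addition, suppose that $\lambda<1$ and $\lambda_n<n$ for all $n$. Then the sequence of stationary occupancy states $q_n$ converges weakly in $\ell_1$ to the deterministic sequence $q^*$ given by $q^*(0)=1$, $q^*(1)=\lambda$ and $q^*(i)=\lambda q^*(i-1)\varphi(q^*(i-1))$ for all $i>1$, where $\varphi(x):=\sum_{d=0}^\infty x^dp(d)$ for $x\in[0,1]$.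
   Context: Conventions: $\mathbb{N}$ includes $0$; $\ell_1$ is the space of absolutely summable $x\in\mathbb{R}^{\mathbb{N}}$ with norm $\|x\|_1=\sum_{i\ge0}|x(i)|$. Model. There are $n$ single-server queues (servers) $V_n=\{1,\dots,n\}$ with infinite buffers. Tasks arrive at each server as independent Poisson processes of rate $\lambda_n/n$, where $\lambda_n>0$; service times are independent and exponential with unit mean. A simple directed graph $\mathbf{G}_n(t)$ on $V_n$, with edge set $\mathbf{E}_n(t)$, is in effect at time $t$; it is replaced, at the jump times of a Poisson process of rate $\mu_n$ that is independent of everything else, by an independent sample from a fixed random graph law $G_n$ that is invariant under permutations of the nodes (relabeling nodes by any fixed permutation of $V_n$ does not change the law). A task arriving at server $u$ at time $t$ joins the queue of a server with the fewest tasks among $u$ and all $v$ such that $(u,v)\in\mathbf{E}_n(t)$ (ties broken arbitrarily). Let $\mathbf{X}_n(t,u)$ be the number of tasks at server $u$ at time $t$. Then $(\mathbf{X}_n,\mathbf{G}_n)$ is a continuous-time Markov chain, with state space the set of elements of $\mathbb{N}^n\times\mathrm{supp}(G_n)$ reachable from a state $(0,g)$ with $g\in\mathrm{supp}(G_n)$; it is irreducible, and if $\lambda_n<n$ it has a unique stationary distribution. The stationary occupancy state $q_n$ is the random sequence $q_n(i)=\frac1n\sum_{u=1}^n\mathbf{1}_{\{X(u)\ge i\}}$, $i\in\mathbb{N}$, where $(X,G)$ has this stationary distribution. $p_n(d)$ is the probability that the outdegree of a node chosen uniformly at random in a sample of $G_n$ equals $d$. The constants $d_n^-\ge0$ are such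 that every node of a sample of $G_n$ has indegree at most $d_n^-$ with probability one. *)

theory Defs
  imports "HOL-Probability.Probability"
begin

section \<open>The sequence space \<open>\<ell>\<^sub>1\<close> and weak convergence\<close>

typedef ell1 = "{x :: nat \<Rightarrow> real. summable (\<lambda>i. \<bar>x i\<bar>)}"
  morphisms coord Abs_ell1
  by (rule exI[of _ "\<lambda>_. 0"]) simp

setup_lifting type_definition_ell1

lemma summable_abs_add:
  fixes x y :: "nat \<Rightarrow> real"
  assumes "summable (\<lambda>i. \<bar>x i\<bar>)" "summable (\<lambda>i. \<bar>y i\<bar>)"
  shows "summable (\<lambda>i. \<bar>x i + y i\<bar>)"
  by (rule summable_comparison_test'[OF summable_add[OF assms], of 0]) auto

lemma summable_coord: "summable (\<lambda>i. \<bar>coord x i\<bar>)"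
  using coord[of x] by simp

instantiation ell1 :: real_normed_vector
begin

lift_definition zero_ell1 :: ell1 is "\<lambda>_. 0" by simp

lift_definition plus_ell1 :: "ell1 \<Rightarrow> ell1 \<Rightarrow> ell1" is "\<lambda>x y i. x i + y i"
  by (rule summable_abs_add)

lift_definition uminus_ell1 :: "ell1 \<Rightarrow> ell1" is "\<lambda>x i. - x i" by simp

lift_definition minus_ell1 :: "ell1 \<Rightarrow> ell1 \<Rightarrow> ell1" is "\<lambda>x y i. x i - y i"
proof -
  fix x y :: "nat \<Rightarrow> real"
  assume "summable (\<lambda>i. \<bar>x i\<bar>)" "summable (\<lambda>i. \<bar>y i\<bar>)"
  then show "summable (\<lambda>i. \<bar>x i - y i\<bar>)"
    using summable_abs_add[of x "\<lambda>i. - y i"] by simp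
qed

lift_definition scaleR_ell1 :: "real \<Rightarrow> ell1 \<Rightarrow> ell1" is "\<lambda>c x i. c * x i"
  by (simp add: abs_mult summable_mult)

lift_definition norm_ell1 :: "ell1 \<Rightarrow> real" is "\<lambda>x. \<Sum>i. \<bar>x i\<bar>" .

definition dist_ell1 :: "ell1 \<Rightarrow> ell1 \<Rightarrow> real" where
  "dist_ell1 x y = norm (x - y)"

definition sgn_ell1 :: "ell1 \<Rightarrow> ell1" where
  "sgn_ell1 x = scaleR (inverse (norm x)) x"

definition uniformity_ell1 :: "(ell1 \<times> ell1) filter" where
  "uniformity_ell1 = (INF e\<in>{0<..}. principal {(x, y). dist x y < e})"

definition open_ell1 :: "ell1 set \<Rightarrow> bool" where
  "open_ell1 U = (\<forall>x\<in>U. eventually (\<lambda>(x', y). x' = x \<longrightarrow> y \<in> U) uniformity)"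

instance
proof
  fix x y z :: ell1 and a b :: real
  show "x + y + z = x + (y + z)" by transfer (simp add: add.assoc)
  show "x + y = y + x" by transfer (simp add: add.commute)
  show "0 + x = x" by transfer simp
  show "- x + x = 0" by transfer simp
  show "x - y = x + - y" by transfer simp
  show "a *\<^sub>R (x + y) = a *\<^sub>R x + a *\<^sub>R y" by transfer (simp add: distrib_left)
  show "(a + b) *\<^sub>R x = a *\<^sub>R x + b *\<^sub>R x" by transfer (simp add: distrib_right)
  show "a *\<^sub>R b *\<^sub>R x = (a * b) *\<^sub>R x" by transfer (simp add: mult.assoc)
  show "1 *\<^sub>R x = x" by transfer simp
  show "dist x y = norm (x - y)" by (rule dist_ell1_def)
  show "sgn x = scaleR (inverse (norm x)) x" by (rule sgn_ell1_def)
  show "uniformity = (INF e\<in>{0<..}. principal {(x, y :: ell1). dist x y < e})"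
    by (rule uniformity_ell1_def)
  show "open U = (\<forall>x\<in>U. eventually (\<lambda>(x', y). x' = x \<longrightarrow> y \<in> U) uniformity)"
    for U :: "ell1 set" by (rule open_ell1_def)
  show "norm x = 0 \<longleftrightarrow> x = 0"
    by transfer (auto simp: suminf_eq_zero_iff)
  show "norm (x + y) \<le> norm x + norm y"
  proof transfer
    fix x y :: "nat \<Rightarrow> real"
    assume s: "summable (\<lambda>i. \<bar>x i\<bar>)" "summable (\<lambda>i. \<bar>y i\<bar>)"
    have "(\<Sum>i. \<bar>x i + y i\<bar>) \<le> (\<Sum>i. \<bar>x i\<bar> + \<bar>y i\<bar>)"
      by (rule suminf_le[OF _ summable_abs_add[OF s] summable_add[OF s]]) (rule abs_triangle_ineq)
    then show "(\<Sum>i. \<bar>x i + y i\<bar>) \<le> (\<Sum>i. \<bar>x i\<bar>) + (\<Sum>i. \<bar>y i\<bar>)"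
      by (simp add: suminf_add[OF s])
  qed
  show "norm (a *\<^sub>R x) = \<bar>a\<bar> * norm x"
    by transfer (simp add: abs_mult suminf_mult)
qed

end

definition weakly_converges ::
    "(nat \<Rightarrow> 'a :: topological_space measure) \<Rightarrow> 'a measure \<Rightarrow> bool" where
  "weakly_converges M N \<longleftrightarrow>
     (\<forall>f :: 'a \<Rightarrow> real. continuous_on UNIV f \<longrightarrow> bounded (range f) \<longrightarrow>
        (\<lambda>n. integral\<^sup>L (M n) f) \<longlonglongrightarrow> integral\<^sup>L N f)"


section \<open>Continuous-time Markov chains on a countable state space\<close>

text \<open>
  \<open>P t x\<close> is the law at time \<open>t\<close> of the chain started at \<open>x\<close>, and \<open>Q\<close> is the generator
  (Q-matrix). \<open>P\<close> is unconstrained outside \<open>S\<close> and for negative times.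
\<close>

definition ctmc :: "'s set \<Rightarrow> ('s \<Rightarrow> 's \<Rightarrow> real) \<Rightarrow> (real \<Rightarrow> 's \<Rightarrow> 's pmf) \<Rightarrow> bool" where
  "ctmc S Q P \<longleftrightarrow>
     (\<forall>t\<ge>0. \<forall>x\<in>S. set_pmf (P t x) \<subseteq> S) \<and>
     (\<forall>x\<in>S. P 0 x = return_pmf x) \<and>
     (\<forall>s\<ge>0. \<forall>t\<ge>0. \<forall>x\<in>S. P (s + t) x = bind_pmf (P s x) (P t)) \<and>
     (\<forall>x\<in>S. \<forall>y\<in>S. ((\<lambda>t. pmf (P t x) y) has_real_derivative Q x y) (at_right 0))"

definition stationary_distribution ::
    "'s set \<Rightarrow> (real \<Rightarrow> 's \<Rightarrow> 's pmf) \<Rightarrow> 's pmf \<Rightarrow> bool" where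
  "stationary_distribution S P \<pi> \<longleftrightarrow> set_pmf \<pi> \<subseteq> S \<and> (\<forall>t\<ge>0. bind_pmf \<pi> (P t) = \<pi>)"

definition reachable :: "('s \<Rightarrow> 's \<Rightarrow> real) \<Rightarrow> 's set \<Rightarrow> 's set" where
  "reachable Q A = {(x, y). x \<noteq> y \<and> Q x y > 0}\<^sup>* `` A"


section \<open>Random directed graphs on the servers \<open>1, \<dots>, n\<close>\<close>

text \<open>A simple directed graph is represented by its edge relation.\<close>

definition simple_digraph :: "nat \<Rightarrow> nat rel \<Rightarrow> bool" where
  "simple_digraph n E \<longleftrightarrow> E \<subseteq> {1..n} \<times> {1..n} \<and> irrefl E"

definition outdegree :: "nat rel \<Rightarrow> nat \<Rightarrow> nat" where
  "outdegree E u = card (E `` {u})"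

definition indegree :: "nat rel \<Rightarrow> nat \<Rightarrow> nat" where
  "indegree E v = card (E\<inverse> `` {v})"

definition permutation_invariant :: "nat \<Rightarrow> nat rel pmf \<Rightarrow> bool" where
  "permutation_invariant n G \<longleftrightarrow>
     (\<forall>\<sigma>. \<sigma> permutes {1..n} \<longrightarrow> map_pmf (\<lambda>E. map_prod \<sigma> \<sigma> ` E) G = G)"

definition outdegree_pmf :: "nat \<Rightarrow> nat rel pmf \<Rightarrow> nat pmf" where
  "outdegree_pmf n G = do {E \<leftarrow> G; u \<leftarrow> pmf_of_set {1..n}; return_pmf (outdegree E u)}"


section \<open>The load balancing model\<close>

text \<open>
  A state consists of the queue lengths, which remain \<open>0\<close> outside the servers \<open>1, \<dots>, n\<close>, and the
  current graph. A dispatching rule gives, for the current state and the server \<open>u\<close> at which a task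
  arrives, the law of the server whose queue the task joins: deterministic and randomized
  tie-breaking are both covered.
\<close>

type_synonym state = "(nat \<Rightarrow> nat) \<times> nat rel"
type_synonym dispatch = "state \<Rightarrow> nat \<Rightarrow> nat pmf"

definition joins_shortest_queue :: "nat \<Rightarrow> nat rel pmf \<Rightarrow> dispatch \<Rightarrow> bool" where
  "joins_shortest_queue n G D \<longleftrightarrow>
     (\<forall>x. \<forall>E\<in>set_pmf G. \<forall>u\<in>{1..n}. \<forall>v\<in>set_pmf (D (x, E) u).
        is_arg_min x (\<lambda>w. w \<in> insert u (E `` {u})) v)"

definition arrival :: "dispatch \<Rightarrow> nat \<Rightarrow> state \<Rightarrow> state pmf" where
  "arrival D u s = (case s of (x, E) \<Rightarrow> map_pmf (\<lambda>v. (x(v := x v + 1), E)) (D s u))"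

text \<open>A potential departure from an empty queue has no effect, as \<open>0 - 1 = 0\<close> on \<open>nat\<close>.\<close>

definition departure :: "nat \<Rightarrow> state \<Rightarrow> state pmf" where
  "departure u s = (case s of (x, E) \<Rightarrow> return_pmf (x(u := x u - 1), E))"

definition resampling :: "nat rel pmf \<Rightarrow> state \<Rightarrow> state pmf" where
  "resampling G s = (case s of (x, E) \<Rightarrow> map_pmf (\<lambda>E'. (x, E')) G)"

text \<open>
  Events that occur at rate \<open>r\<close> and move the state according to the kernel \<open>K\<close> contribute
  \<open>r (K - I)\<close> to the generator; events that leave the state unchanged thus contribute \<open>0\<close>.
\<close>

definition event :: "real \<Rightarrow> ('s \<Rightarrow> 's pmf) \<Rightarrow> 's \<Rightarrow> 's \<Rightarrow> real" where
  "event r K s s' = r * (pmf (K s) s' - pmf (return_pmf s) s')"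

definition generator ::
    "nat \<Rightarrow> real \<Rightarrow> real \<Rightarrow> nat rel pmf \<Rightarrow> dispatch \<Rightarrow> state \<Rightarrow> state \<Rightarrow> real" where
  "generator n lam mu G D s s' =
     (\<Sum>u\<in>{1..n}. event (lam / real n) (arrival D u) s s') +
     (\<Sum>u\<in>{1..n}. event 1 (departure u) s s') +
     event mu (resampling G) s s'"

definition state_space :: "nat \<Rightarrow> real \<Rightarrow> real \<Rightarrow> nat rel pmf \<Rightarrow> dispatch \<Rightarrow> state set" where
  "state_space n lam mu G D = reachable (generator n lam mu G D) ({\<lambda>_. 0} \<times> set_pmf G)"

lift_definition occupancy :: "nat \<Rightarrow> state \<Rightarrow> ell1" is
  "\<lambda>n (x, E) i. real (card {u\<in>{1..n}. x u \<ge> i}) / real n"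
proof -
  fix n :: nat and s :: state
  obtain x E where s: "s = (x, E)" by (cases s)
  have le: "x u \<le> (\<Sum>v\<in>{1..n}. x v)" if "u \<in> {1..n}" for u
    by (rule member_le_sum[OF that]) simp_all
  have empty: "{u\<in>{1..n}. x u \<ge> i} = {}" if "i \<notin> {..\<Sum>v\<in>{1..n}. x v}" for i
  proof -
    have "\<not> i \<le> x u" if "u \<in> {1..n}" for u
      using le[OF that] \<open>i \<notin> _\<close> by (simp only: atMost_iff)
    then show ?thesis by blast
  qed
  have "summable (\<lambda>i. \<bar>real (card {u\<in>{1..n}. x u \<ge> i}) / real n\<bar>)"
    by (rule summable_finite[of "{..\<Sum>v\<in>{1..n}. x v}"]) (rule finite_atMost, subst empty, assumption, simp)
  then show "summable (\<lambda>i. \<bar>(case s of (x, E) \<Rightarrow> \<lambda>i. real (card {u\<in>{1..n}. x u \<ge> i}) / real n) i\<bar>)"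
    by (simp add: s)
qed


section \<open>The limit\<close>

definition phi :: "(nat \<Rightarrow> real) \<Rightarrow> real \<Rightarrow> real" where
  "phi p x = (\<Sum>d. x ^ d * p d)"

fun qstar :: "real \<Rightarrow> (nat \<Rightarrow> real) \<Rightarrow> nat \<Rightarrow> real" where
  "qstar lam p 0 = 1"
| "qstar lam p (Suc 0) = lam"
| "qstar lam p (Suc (Suc i)) = lam * qstar lam p (Suc i) * phi p (qstar lam p (Suc i))"

end

theory Submission
  imports Defs
begin

text \<open>
  Write \<open>\<rho> = lam / n\<close>, let \<open>q i\<close> be the fraction of servers with at least \<open>i\<close> tasks, and let \<open>B i\<close>
  be the fraction of servers \<open>u\<close> such that \<open>u\<close> and all its out-neighbours have at least \<open>i\<close> tasks. A
  task arriving at \<open>u\<close> joins a queue of length exactly \<open>i - 1\<close> iff the shortest queue in the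
  neighbourhood of \<open>u\<close> has that length, so the generator maps \<open>q i\<close> to
  \<open>\<rho> (B (i - 1) - B i) - (q i - q (i + 1))\<close>, whatever the tie-breaking rule. The proof never
  follows the process in time: under the stationary distribution the generator of every bounded
  function has mean \<open>0\<close> (\<open>stationary_drift\<close>), and three families of test functions suffice.

  Tails. The functions \<open>q (k + 1) + \<dots> + q m\<close> yield \<open>E (q (k + 1)) \<le> \<rho> E (B k) \<le> \<rho> E (q k)\<close>,
  hence \<open>E (q k) \<le> \<rho> ^ k\<close> (\<open>occ_decay\<close>).

  Averaging. Let \<open>\<beta> i\<close> be the mean of \<open>B i\<close> over an independent graph, the queue lengths being held
  fixed. Let \<open>F\<close> be a bounded function of the queue lengths that each arrival or departure changes by
  \<open>O(1/n)\<close>. The resampling part of the generator multiplies \<open>F (B i - \<beta> i)\<close> by \<open>-\<mu>\<close>, while an arrival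
  or departure at \<open>v\<close> only affects the neighbourhoods containing \<open>v\<close>, of which there are at most
  \<open>dm + 1\<close>. Therefore \<open>E (F (B i - \<beta> i)) = O ((dm + 1) / \<mu>)\<close> (\<open>graph_averaging\<close>).
  By permutation invariance \<open>\<beta> i\<close> depends on \<open>q i\<close> alone, and it is uniformly close to \<open>b (q i)\<close>,
  where \<open>b x = x \<phi>(x)\<close> (\<open>permutation_invariant_mean\<close>, \<open>choose_ratio_uniform_limit\<close>).

  Contraction. The occupancies thus obey, on average, the vector field
  \<open>\<lambda> (b (q (i - 1)) - b (q i)) - (q i - q (i + 1))\<close>, which vanishes at \<open>qstar\<close>. It has the form of a
  discrete conservation law with increasing fluxes, and such systems contract the \<open>\<ell>\<^sub>1\<close> distance:
  since \<open>b (q i) - b (qstar i)\<close> has the sign of \<open>q i - qstar i\<close>, the drift of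
  \<open>\<bar>q k - qstar k\<bar> + \<bar>q (k + 1) - qstar (k + 1)\<bar> + \<dots>\<close> telescopes to at most
  \<open>\<lambda> \<bar>b (q (k - 1)) - b (qstar (k - 1))\<bar> - \<bar>q k - qstar k\<bar>\<close>. As \<open>b\<close> is Lipschitz, which is where the
  finite mean of \<open>p\<close> enters, \<open>E \<bar>q k - qstar k\<bar>\<close> tends to \<open>0\<close> as soon as
  \<open>E \<bar>q (k - 1) - qstar (k - 1)\<bar>\<close> does (\<open>contraction_step\<close>), and \<open>q 0 = qstar 0 = 1\<close> starts the induction.

  Coordinatewise convergence and the geometric tails show that the expected \<open>\<ell>\<^sub>1\<close> distance of \<open>q\<close> to
  \<open>qstar\<close> tends to \<open>0\<close>, which implies weak convergence to the point mass at \<open>qstar\<close>.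
\<close>

section \<open>Expectations under probability mass functions\<close>

lemma integrable_pmf_bounded:
  fixes f :: "'a \<Rightarrow> real"
  assumes "\<And>x. x \<in> set_pmf p \<Longrightarrow> \<bar>f x\<bar> \<le> B"
  shows "integrable (measure_pmf p) f"
  using assms by (intro measure_pmf.integrable_const_bound[of _ B]) (auto simp: AE_measure_pmf_iff)

lemma integral_pmf_bounded:
  fixes f :: "'a \<Rightarrow> real"
  assumes "\<And>x. x \<in> set_pmf p \<Longrightarrow> \<bar>f x\<bar> \<le> B"
  shows "\<bar>\<integral>x. f x \<partial>measure_pmf p\<bar> \<le> B"
proof -
  have int: "integrable p (\<lambda>x. \<bar>f x\<bar>)"
    using assms by (intro integrable_pmf_bounded[of _ _ B]) auto
  have "\<bar>\<integral>x. f x \<partial>measure_pmf p\<bar> \<le> (\<integral>x. \<bar>f x\<bar> \<partial>measure_pmf p)"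
    by (rule integral_abs_bound)
  also have "\<dots> \<le> (\<integral>x. B \<partial>measure_pmf p)"
    using int assms by (intro integral_mono_AE) (auto simp: AE_measure_pmf_iff)
  finally show ?thesis by simp
qed

lemma integral_pmf_cong:
  fixes f g :: "'a \<Rightarrow> real"
  assumes "\<And>x. x \<in> set_pmf p \<Longrightarrow> f x = g x"
  shows "(\<integral>x. f x \<partial>measure_pmf p) = (\<integral>x. g x \<partial>measure_pmf p)"
  using assms by (intro integral_cong_AE) (auto simp: AE_measure_pmf_iff)

lemma integral_pmf_mono:
  fixes f g :: "'a \<Rightarrow> real"
  assumes "integrable (measure_pmf p) f" "integrable (measure_pmf p) g"
    and "\<And>x. x \<in> set_pmf p \<Longrightarrow> f x \<le> g x"
  shows "(\<integral>x. f x \<partial>measure_pmf p) \<le> (\<integral>x. g x \<partial>measure_pmf p)"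
  using assms by (intro integral_mono_AE) (auto simp: AE_measure_pmf_iff)

lemma integral_pmf_count_space:
  fixes f :: "'a \<Rightarrow> real"
  shows "(\<integral>x. f x \<partial>measure_pmf p) = (\<integral>x. pmf p x * f x \<partial>count_space UNIV)"
  unfolding measure_pmf_eq_density
  by (subst integral_density) auto

lemma integrable_count_space_pmf:
  fixes f :: "'a \<Rightarrow> real"
  assumes "integrable (measure_pmf p) f"
  shows "integrable (count_space UNIV) (\<lambda>x. pmf p x * f x)"
  using assms unfolding measure_pmf_eq_density
  by (subst (asm) integrable_density) auto

lemma integral_bind_pmf_bounded:
  fixes f :: "'b \<Rightarrow> real"
  assumes "\<And>y. \<bar>f y\<bar> \<le> B"
  shows "(\<integral>y. f y \<partial>bind_pmf p K) = (\<integral>x. (\<integral>y. f y \<partial>K x) \<partial>p)"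
  unfolding measure_pmf_bind
  by (rule integral_bind[where K="count_space UNIV" and B=B and B'=1])
     (use assms measure_pmf_in_subprob_algebra in \<open>auto simp: measure_pmf.finite_measure_axioms
        measure_pmf.emeasure_space_1 AE_measure_pmf_iff\<close>)

section \<open>Stationary distributions and the generator\<close>

text \<open>
  The escape probability \<open>1 - pmf (P t s) s\<close> is subadditive in \<open>t\<close>, so it lies below its tangent
  at \<open>0\<close>. This turns the derivative at \<open>0\<close> into a bound for all times, which later serves as the
  dominating function.
\<close>

lemma ctmc_escape_bound:
  assumes P: "ctmc S Q P" and s: "s \<in> S" and t: "0 \<le> t"
  shows "1 - pmf (P t s) s \<le> - Q s s * t"
proof (cases "t = 0")
  case True
  then show ?thesis using P s by (simp add: ctmc_def)
next
  case False
  with t have t: "0 < t" by simp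
  define l where "l t = 1 - pmf (P t s) s" for t
  have sub: "l (a + b) \<le> l a + l b" if "0 \<le> a" "0 \<le> b" for a b
  proof -
    have "pmf (P (a + b) s) s = (\<integral>x. pmf (P b x) s \<partial>P a s)"
      using P s that by (simp add: ctmc_def pmf_bind)
    also have "\<dots> \<ge> (\<integral>x. pmf (P b s) s * indicator {s} x \<partial>P a s)"
      by (intro integral_pmf_mono integrable_pmf_bounded[of _ _ 1])
         (auto simp: pmf_le_1 indicator_def)
    also have "(\<integral>x. pmf (P b s) s * indicator {s} x \<partial>P a s) = pmf (P b s) s * pmf (P a s) s"
      by (simp add: measure_pmf_single)
    finally have "pmf (P b s) s * pmf (P a s) s \<le> pmf (P (a + b) s) s" .
    moreover have "0 \<le> (1 - pmf (P b s) s) * (1 - pmf (P a s) s)"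
      by (intro mult_nonneg_nonneg) (auto simp: pmf_le_1)
    ultimately show ?thesis unfolding l_def by (simp add: algebra_simps)
  qed
  have l0: "l 0 = 0" using P s by (simp add: l_def ctmc_def)
  have multi: "l (real m * a) \<le> real m * l a" if "0 \<le> a" for a m
  proof (induction m)
    case (Suc m)
    show ?case using sub[of "real m * a" a] Suc that by (simp add: algebra_simps)
  qed (simp add: l0)
  have "((\<lambda>t. (pmf (P t s) s - pmf (P 0 s) s) / (t - 0)) \<longlongrightarrow> Q s s) (at_right 0)"
    using P s unfolding ctmc_def has_field_derivative_iff by blast
  then have "((\<lambda>t. - ((pmf (P t s) s - pmf (P 0 s) s) / (t - 0))) \<longlongrightarrow> - Q s s) (at_right 0)"
    by (rule tendsto_minus)
  moreover have "filterlim (\<lambda>m. t / real (Suc m)) (at_right 0) sequentially"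
    unfolding filterlim_at using t
    by (auto intro!: eventuallyI LIMSEQ_Suc[OF lim_const_over_n] simp del: of_nat_Suc)
  ultimately have "(\<lambda>m. - ((pmf (P (t / real (Suc m)) s) s - pmf (P 0 s) s) / (t / real (Suc m) - 0)))
      \<longlonglongrightarrow> - Q s s"
    by (rule filterlim_compose)
  moreover have "- ((pmf (P (t / real (Suc m)) s) s - pmf (P 0 s) s) / (t / real (Suc m) - 0)) \<ge> l t / t" for m
  proof -
    have "l t \<le> real (Suc m) * l (t / real (Suc m))"
      using multi[of "t / real (Suc m)" "Suc m"] t by simp
    then have "l t / t \<le> real (Suc m) * l (t / real (Suc m)) / t"
      using t by (intro divide_right_mono) auto
    also have "pmf (P 0 s) s = 1" using l0 by (simp add: l_def)
    then have "real (Suc m) * l (t / real (Suc m)) / t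
        = - ((pmf (P (t / real (Suc m)) s) s - pmf (P 0 s) s) / (t / real (Suc m) - 0))"
      by (simp add: l_def minus_divide_left[symmetric] del: of_nat_Suc) (simp add: field_simps minus_divide_left del: of_nat_Suc)
    finally show ?thesis .
  qed
  ultimately have "l t / t \<le> - Q s s" by (intro LIMSEQ_le_const) auto
  then show ?thesis using t by (simp add: l_def field_simps)
qed

text \<open>
  The difference quotients of \<open>\<lambda>t. pmf (P t s) y\<close> at \<open>0\<close> have mean \<open>0\<close> under a stationary
  distribution. They converge to \<open>Q s y\<close> and are bounded by \<open>C\<close> because a chain that reaches \<open>y\<close>
  from another state has escaped, so dominated convergence applies.
\<close>

lemma ctmc_global_balance:
  assumes P: "ctmc S Q P" and st: "stationary_distribution S P \<pi>"
    and C: "\<And>s. s \<in> S \<Longrightarrow> - Q s s \<le> C" and y: "y \<in> S"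
  shows "(\<integral>s. Q s y \<partial>\<pi>) = 0"
proof -
  define t where "t m = 1 / real (Suc m)" for m
  have tpos: "0 < t m" for m by (simp add: t_def)
  have tlim: "filterlim t (at_right 0) sequentially"
    unfolding filterlim_at t_def
    by (auto intro!: eventuallyI LIMSEQ_Suc[OF lim_const_over_n] simp del: of_nat_Suc)
  define F where "F m s = (pmf (P (t m) s) y - pmf (P 0 s) y) / t m" for m s
  have sub: "set_pmf \<pi> \<subseteq> S" using st by (simp add: stationary_distribution_def)
  have lim: "(\<lambda>m. F m s) \<longlonglongrightarrow> Q s y" if "s \<in> S" for s
  proof -
    have "((\<lambda>t. (pmf (P t s) y - pmf (P 0 s) y) / (t - 0)) \<longlongrightarrow> Q s y) (at_right 0)"
      using P that y unfolding ctmc_def has_field_derivative_iff by blast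
    from filterlim_compose[OF this tlim] show ?thesis by (simp add: F_def)
  qed
  have bd: "\<bar>F m s\<bar> \<le> C" if s: "s \<in> S" for m s
  proof -
    have esc: "1 - pmf (P (t m) s) s \<le> C * t m"
      using ctmc_escape_bound[OF P s, of "t m"] C[OF s] tpos[of m]
      by (smt (verit) mult_right_mono)
    have P0: "P 0 s = return_pmf s" using P s by (simp add: ctmc_def)
    have "\<bar>pmf (P (t m) s) y - pmf (P 0 s) y\<bar> \<le> 1 - pmf (P (t m) s) s"
    proof (cases "s = y")
      case True
      then show ?thesis using P0 by (simp add: pmf_le_1)
    next
      case False
      have "pmf (P (t m) s) y + pmf (P (t m) s) s = measure (P (t m) s) {y, s}"
        using False by (subst measure_measure_pmf_finite) auto
      also have "\<dots> \<le> 1" by simp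
      finally show ?thesis using False by (simp add: P0)
    qed
    with esc show ?thesis using tpos[of m] by (simp add: F_def field_simps abs_divide)
  qed
  have zero: "(\<integral>s. F m s \<partial>\<pi>) = 0" for m
  proof -
    have "pmf \<pi> y = (\<integral>s. pmf (P (t m) s) y \<partial>\<pi>)"
      using st tpos[of m] by (metis less_imp_le pmf_bind stationary_distribution_def)
    moreover have "pmf \<pi> y = (\<integral>s. pmf (P 0 s) y \<partial>\<pi>)"
      using st by (metis order_refl pmf_bind stationary_distribution_def)
    moreover have "integrable \<pi> (\<lambda>s. pmf (P r s) y)" for r
      by (intro integrable_pmf_bounded[of _ _ 1]) (auto simp: pmf_le_1)
    ultimately show ?thesis by (simp add: F_def)
  qed
  have "(\<lambda>m. \<integral>s. F m s \<partial>\<pi>) \<longlonglongrightarrow> (\<integral>s. Q s y \<partial>\<pi>)"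
    by (rule integral_dominated_convergence[where w="\<lambda>_. C"])
       (use sub lim bd in \<open>auto simp: AE_measure_pmf_iff\<close>)
  then show ?thesis by (simp add: zero LIMSEQ_const_iff)
qed

text \<open>
  The global balance equation is an identity between the finitely many laws \<open>bind_pmf \<pi> (K j)\<close>
  and \<open>\<pi>\<close>, which holds state by state and can therefore be integrated against \<open>f\<close>.
\<close>

lemma stationary_events:
  fixes f :: "'s \<Rightarrow> real"
  assumes P: "ctmc S Q P" and st: "stationary_distribution S P \<pi>"
    and Q: "\<And>s s'. Q s s' = (\<Sum>j\<in>J. event (r j) (K j) s s')"
    and J: "finite J" and r: "\<And>j. j \<in> J \<Longrightarrow> 0 \<le> r j"
    and closed: "\<And>j s. j \<in> J \<Longrightarrow> s \<in> S \<Longrightarrow> set_pmf (K j s) \<subseteq> S"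
    and f: "\<And>s. \<bar>f s\<bar> \<le> B"
  shows "(\<Sum>j\<in>J. r j * ((\<integral>s. (\<integral>s'. f s' \<partial>K j s) \<partial>\<pi>) - (\<integral>s. f s \<partial>\<pi>))) = 0"
proof -
  have sub: "set_pmf \<pi> \<subseteq> S" using st by (simp add: stationary_distribution_def)
  have balance: "(\<Sum>j\<in>J. r j * (pmf (bind_pmf \<pi> (K j)) y - pmf \<pi> y)) = 0" for y
  \<comment> \<open>global balance speaks about states of \<open>S\<close>; elsewhere all the laws involved vanish\<close>
  proof (cases "y \<in> S")
    case True
    have int: "integrable \<pi> (\<lambda>s. pmf (K s) y)" for K :: "'s \<Rightarrow> 's pmf"
      by (intro integrable_pmf_bounded[of _ _ 1]) (auto simp: pmf_le_1)
    have "- Q s s \<le> (\<Sum>j\<in>J. r j)" for s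
      unfolding Q event_def sum_negf[symmetric]
      by (intro sum_mono) (use r in \<open>auto simp: right_diff_distrib mult_left_le\<close>)
    then have "0 = (\<integral>s. Q s y \<partial>\<pi>)"
      using ctmc_global_balance[OF P st _ True, of "\<Sum>j\<in>J. r j"] by simp
    also have "\<dots> = (\<Sum>j\<in>J. r j * ((\<integral>s. pmf (K j s) y \<partial>\<pi>) - (\<integral>s. pmf (return_pmf s) y \<partial>\<pi>)))"
      unfolding Q event_def using int int[of return_pmf]
      by (subst Bochner_Integration.integral_sum) (auto simp del: pmf_return)
    also have "\<dots> = (\<Sum>j\<in>J. r j * (pmf (bind_pmf \<pi> (K j)) y - pmf \<pi> y))"
      unfolding pmf_bind[symmetric] bind_return_pmf' ..
    finally show ?thesis ..
  next
    case False
    have "pmf (bind_pmf \<pi> (K j)) y = 0" if "j \<in> J" for j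
      using closed[OF that] sub False by (auto simp: pmf_eq_0_set_pmf)
    moreover have "pmf \<pi> y = 0" using sub False by (auto simp: pmf_eq_0_set_pmf)
    ultimately show ?thesis by simp
  qed
  have int: "integrable (count_space UNIV) (\<lambda>y. pmf q y * f y)" for q :: "'s pmf"
    using f by (intro integrable_count_space_pmf integrable_pmf_bounded)
  have "(\<Sum>j\<in>J. r j * ((\<integral>s. (\<integral>s'. f s' \<partial>K j s) \<partial>\<pi>) - (\<integral>s. f s \<partial>\<pi>)))
      = (\<Sum>j\<in>J. r j * ((\<integral>y. pmf (bind_pmf \<pi> (K j)) y * f y \<partial>count_space UNIV)
          - (\<integral>y. pmf \<pi> y * f y \<partial>count_space UNIV)))"
    by (simp only: integral_pmf_count_space[symmetric] integral_bind_pmf_bounded[where f=f, OF f])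
  also have "\<dots> = (\<integral>y. (\<Sum>j\<in>J. r j * (pmf (bind_pmf \<pi> (K j)) y * f y - pmf \<pi> y * f y)) \<partial>count_space UNIV)"
    using int by (subst Bochner_Integration.integral_sum) auto
  also have "(\<lambda>y. \<Sum>j\<in>J. r j * (pmf (bind_pmf \<pi> (K j)) y * f y - pmf \<pi> y * f y)) = (\<lambda>_. 0)"
  proof
    fix y
    have "(\<Sum>j\<in>J. r j * (pmf (bind_pmf \<pi> (K j)) y * f y - pmf \<pi> y * f y))
        = (\<Sum>j\<in>J. r j * (pmf (bind_pmf \<pi> (K j)) y - pmf \<pi> y)) * f y"
      by (simp add: sum_distrib_right left_diff_distrib mult.assoc right_diff_distrib)
    then show "(\<Sum>j\<in>J. r j * (pmf (bind_pmf \<pi> (K j)) y * f y - pmf \<pi> y * f y)) = 0"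
      by (simp add: balance)
  qed
  finally show ?thesis by simp
qed

section \<open>The model as a superposition of events\<close>

lemma event_nonneg: "0 \<le> r \<Longrightarrow> s \<noteq> s' \<Longrightarrow> 0 \<le> event r K s s'"
  by (simp add: event_def)

lemma reachable_events_closed:
  assumes Q: "\<And>s s'. Q s s' = (\<Sum>j\<in>J. event (r j) (K j) s s')"
    and J: "finite J" and r: "\<And>j. j \<in> J \<Longrightarrow> 0 < r j"
    and j: "j \<in> J" and s: "s \<in> reachable Q A"
  shows "set_pmf (K j s) \<subseteq> reachable Q A"
proof
  fix s' assume s': "s' \<in> set_pmf (K j s)"
  show "s' \<in> reachable Q A"
  proof (cases "s = s'")
    case False
    have "0 < event (r j) (K j) s s'"
      using r[OF j] s' False by (simp add: event_def pmf_positive)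
    also have "\<dots> \<le> Q s s'"
      unfolding Q using r False by (intro member_le_sum j J event_nonneg) (auto intro: less_imp_le)
    finally have "(s, s') \<in> {(x, y). x \<noteq> y \<and> Q x y > 0}" using False by simp
    then show ?thesis using s unfolding reachable_def
      by (auto intro: rtrancl_into_rtrancl)
  qed (use s in simp)
qed

lemma reachable_events_invariant:
  assumes Q: "\<And>s s'. Q s s' = (\<Sum>j\<in>J. event (r j) (K j) s s')"
    and r: "\<And>j. j \<in> J \<Longrightarrow> 0 < r j"
    and step: "\<And>j s s'. j \<in> J \<Longrightarrow> I s \<Longrightarrow> s' \<in> set_pmf (K j s) \<Longrightarrow> I s'"
    and init: "\<And>s. s \<in> A \<Longrightarrow> I s" and s: "s \<in> reachable Q A"
  shows "I s"
proof -
  obtain a where a: "a \<in> A" and path: "(a, s) \<in> {(x, y). x \<noteq> y \<and> Q x y > 0}\<^sup>*"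
    using s by (auto simp: reachable_def)
  from path show ?thesis
  proof (induction rule: rtrancl_induct)
    case base
    then show ?case using init a by simp
  next
    case (step y z)
    then have "y \<noteq> z" "0 < (\<Sum>j\<in>J. event (r j) (K j) y z)" by (auto simp: Q)
    then obtain j where j: "j \<in> J" "0 < event (r j) (K j) y z"
      by (meson not_le sum_nonpos)
    then have "z \<in> set_pmf (K j y)"
      using \<open>y \<noteq> z\<close> by (auto simp: event_def set_pmf_iff)
    then show ?case using assms(3) j(1) step by blast
  qed
qed

type_synonym events = "nat + nat + unit"

text \<open>
  One index type for arrivals, potential departures and resampling lets the generator be a single
  sum over events.
\<close>

definition model_events :: "nat \<Rightarrow> events set" where
  "model_events n = {1..n} <+> ({1..n} <+> {()})"

definition model_rate :: "nat \<Rightarrow> real \<Rightarrow> real \<Rightarrow> events \<Rightarrow> real" where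
  "model_rate n lam mu = case_sum (\<lambda>_. lam / real n) (case_sum (\<lambda>_. 1) (\<lambda>_. mu))"

definition model_kernel :: "nat rel pmf \<Rightarrow> dispatch \<Rightarrow> events \<Rightarrow> state \<Rightarrow> state pmf" where
  "model_kernel G D = case_sum (arrival D) (case_sum departure (\<lambda>_. resampling G))"

lemma sum_model_events:
  "(\<Sum>j\<in>model_events n. g j) = (\<Sum>u\<in>{1..n}. g (Inl u)) + (\<Sum>u\<in>{1..n}. g (Inr (Inl u))) + g (Inr (Inr ()))"
  by (simp add: model_events_def sum.Plus add.assoc)

lemma generator_events:
  "generator n lam mu G D s s' =
     (\<Sum>j\<in>model_events n. event (model_rate n lam mu j) (model_kernel G D j) s s')"
  by (simp add: sum_model_events generator_def model_rate_def model_kernel_def)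

section \<open>The drift of functions of the occupancies\<close>

text \<open>
  The generator applied to the function \<open>f\<close>; integrals over the kernels stand for the sums over
  target states.
\<close>

definition drift :: "nat \<Rightarrow> real \<Rightarrow> real \<Rightarrow> nat rel pmf \<Rightarrow> dispatch \<Rightarrow> (state \<Rightarrow> real) \<Rightarrow> state \<Rightarrow> real" where
  "drift n lam mu G D f s =
     lam / real n * (\<Sum>u\<in>{1..n}. (\<integral>s'. f s' \<partial>arrival D u s) - f s) +
     (\<Sum>u\<in>{1..n}. (\<integral>s'. f s' \<partial>departure u s) - f s) +
     mu * ((\<integral>s'. f s' \<partial>resampling G s) - f s)"

definition occ :: "nat \<Rightarrow> (nat \<Rightarrow> nat) \<Rightarrow> nat \<Rightarrow> real" where
  "occ n x i = (\<Sum>u\<in>{1..n}. of_bool (i \<le> x u)) / real n"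

text \<open>
  The fraction of servers at which an arriving task would see a shortest queue of length at
  least \<open>i\<close>.
\<close>

definition nbhd_occ :: "nat \<Rightarrow> (nat \<Rightarrow> nat) \<Rightarrow> nat rel \<Rightarrow> nat \<Rightarrow> real" where
  "nbhd_occ n x E i = (\<Sum>u\<in>{1..n}. of_bool (\<forall>w\<in>insert u (E `` {u}). i \<le> x w)) / real n"

locale load_balancing =
  fixes n :: nat and lam mu dm :: real and G :: "nat rel pmf" and D :: dispatch
    and P :: "real \<Rightarrow> state \<Rightarrow> state pmf" and \<pi> :: "state pmf"
  assumes n: "1 \<le> n" and lam: "0 < lam" and mu: "0 < mu"
    and graph: "\<And>E. E \<in> set_pmf G \<Longrightarrow> simple_digraph n E"
    and perm: "permutation_invariant n G"
    and jsq: "joins_shortest_queue n G D"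
    and indeg: "\<And>E v. E \<in> set_pmf G \<Longrightarrow> v \<in> {1..n} \<Longrightarrow> real (indegree E v) \<le> dm"
    and chain: "ctmc (state_space n lam mu G D) (generator n lam mu G D) P"
    and stat: "stationary_distribution (state_space n lam mu G D) P \<pi>"
begin

abbreviation "rho \<equiv> lam / real n"

lemma n_pos: "0 < real n" using n by simp
lemma rho_pos: "0 < rho" using n lam by simp

lemma model_rate_pos: "0 < model_rate n lam mu j"
  using lam mu n by (auto simp: model_rate_def split: sum.split)

lemma finite_model_events: "finite (model_events n)" by (simp add: model_events_def)

lemma stationary_graph:
  assumes "(x, E) \<in> set_pmf \<pi>"
  shows "E \<in> set_pmf G"
proof -
  have "snd (x, E) \<in> set_pmf G"
  proof (rule reachable_events_invariant[OF generator_events model_rate_pos,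
        where I="\<lambda>s. snd s \<in> set_pmf G" and A="{\<lambda>_. 0} \<times> set_pmf G"])
    show "(x, E) \<in> reachable (generator n lam mu G D) ({\<lambda>_. 0} \<times> set_pmf G)"
      using stat assms by (auto simp: stationary_distribution_def state_space_def)
  qed (auto simp: model_kernel_def arrival_def departure_def resampling_def split: sum.splits)
  then show ?thesis by simp
qed

lemma stationary_drift:
  fixes f :: "state \<Rightarrow> real"
  assumes f: "\<And>s. \<bar>f s\<bar> \<le> B"
  shows "(\<integral>s. drift n lam mu G D f s \<partial>\<pi>) = 0"
    and "integrable \<pi> (drift n lam mu G D f)"
proof -
  have int: "integrable \<pi> f" "integrable \<pi> (\<lambda>s. \<integral>s'. f s' \<partial>K s)"
    for K :: "state \<Rightarrow> state pmf"
    subgoal by (rule integrable_pmf_bounded[of _ _ B]) (rule f)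
    subgoal by (rule integrable_pmf_bounded[of _ _ B], rule integral_pmf_bounded, rule f)
    done
  have eq: "drift n lam mu G D f = (\<lambda>s. \<Sum>j\<in>model_events n.
      model_rate n lam mu j * ((\<integral>s'. f s' \<partial>model_kernel G D j s) - f s))"
    by (rule ext) (simp add: drift_def sum_model_events model_rate_def model_kernel_def sum_distrib_left)
  show "integrable \<pi> (drift n lam mu G D f)" unfolding eq using int by simp
  have "(\<integral>s. drift n lam mu G D f s \<partial>\<pi>) = (\<Sum>j\<in>model_events n.
      model_rate n lam mu j * ((\<integral>s. (\<integral>s'. f s' \<partial>model_kernel G D j s) \<partial>\<pi>) - (\<integral>s. f s \<partial>\<pi>)))"
    unfolding eq using int by (subst Bochner_Integration.integral_sum) auto
  also have "\<dots> = 0"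
    using model_rate_pos
    by (intro stationary_events[OF chain stat generator_events finite_model_events _ _ f])
       (auto simp: state_space_def intro: less_imp_le
         dest: reachable_events_closed[OF generator_events finite_model_events model_rate_pos])
  finally show "(\<integral>s. drift n lam mu G D f s \<partial>\<pi>) = 0" .
qed

lemma drift_eq:
  "drift n lam mu G D f (x, E) =
     rho * (\<Sum>u\<in>{1..n}. (\<integral>v. f (x(v := x v + 1), E) \<partial>D (x, E) u) - f (x, E)) +
     (\<Sum>u\<in>{1..n}. f (x(u := x u - 1), E) - f (x, E)) +
     mu * ((\<integral>E'. f (x, E') \<partial>G) - f (x, E))"
  by (simp add: drift_def arrival_def departure_def resampling_def)

lemma neighbourhood_subset:
  assumes "E \<in> set_pmf G" "u \<in> {1..n}"
  shows "insert u (E `` {u}) \<subseteq> {1..n}"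
  using graph[OF assms(1)] assms(2) by (auto simp: simple_digraph_def)

lemma dispatch_support:
  assumes "E \<in> set_pmf G" "u \<in> {1..n}" "v \<in> set_pmf (D (x, E) u)"
  shows "v \<in> {1..n}" and "v \<in> insert u (E `` {u})" and "\<And>w. w \<in> insert u (E `` {u}) \<Longrightarrow> x v \<le> x w"
proof -
  have "is_arg_min x (\<lambda>w. w \<in> insert u (E `` {u})) v"
    using jsq assms by (auto simp: joins_shortest_queue_def)
  then show "v \<in> insert u (E `` {u})" "\<And>w. w \<in> insert u (E `` {u}) \<Longrightarrow> x v \<le> x w"
    by (auto simp: is_arg_min_linorder)
  then show "v \<in> {1..n}" using neighbourhood_subset[OF assms(1,2)] by blast
qed

lemma integrable_dispatch:
  fixes f :: "nat \<Rightarrow> real"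
  assumes "E \<in> set_pmf G" "u \<in> {1..n}"
  shows "integrable (D (x, E) u) f"
proof (rule integrable_measure_pmf_finite)
  have "set_pmf (D (x, E) u) \<subseteq> {1..n}" using dispatch_support(1)[OF assms] by blast
  then show "finite (set_pmf (D (x, E) u))" by (rule finite_subset) simp
qed

end

lemma sum_fun_upd_nat:
  fixes h :: "nat \<Rightarrow> real"
  assumes "finite V" "v \<in> V"
  shows "(\<Sum>u\<in>V. h ((x(v := a)) u)) = (\<Sum>u\<in>V. h (x u)) + (h a - h (x v))"
proof -
  have "(\<Sum>u\<in>V - {v}. h ((x(v := a)) u)) = (\<Sum>u\<in>V - {v}. h (x u))"
    by (rule sum.cong) auto
  then show ?thesis
    unfolding sum.remove[OF assms, of "\<lambda>u. h ((x(v := a)) u)"]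
      sum.remove[OF assms, of "\<lambda>u. h (x u)"] by simp
qed

lemma occ_arrival:
  assumes "v \<in> {1..n}" "1 \<le> i"
  shows "occ n (x(v := x v + 1)) i = occ n x i + of_bool (Suc (x v) = i) / real n"
proof -
  have "of_bool (i \<le> x v + 1) - of_bool (i \<le> x v) = (of_bool (Suc (x v) = i) :: real)" by auto
  with sum_fun_upd_nat[OF _ assms(1), of "\<lambda>k. of_bool (i \<le> k)" x "x v + 1"]
  show ?thesis by (simp add: occ_def add_divide_distrib del: fun_upd_apply)
qed

lemma occ_departure:
  assumes "v \<in> {1..n}" "1 \<le> i"
  shows "occ n (x(v := x v - 1)) i = occ n x i - of_bool (x v = i) / real n"
proof -
  have "of_bool (i \<le> x v - 1) - of_bool (i \<le> x v) = - (of_bool (x v = i) :: real)"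
    using assms(2) by auto
  with sum_fun_upd_nat[OF _ assms(1), of "\<lambda>k. of_bool (i \<le> k)" x "x v - 1"]
  show ?thesis by (simp add: occ_def add_divide_distrib diff_divide_distrib del: fun_upd_apply)
qed

lemma occ_nonneg: "0 \<le> occ n x i"
  by (simp add: occ_def sum_nonneg)

lemma occ_le_1: "occ n x i \<le> 1"
proof -
  have "(\<Sum>u\<in>{1..n}. of_bool (i \<le> x u) :: real) \<le> (\<Sum>u\<in>{1..n}. 1)" by (intro sum_mono) auto
  then show ?thesis by (simp add: occ_def divide_le_eq)
qed

lemma nbhd_occ_nonneg: "0 \<le> nbhd_occ n x E i"
  by (simp add: nbhd_occ_def sum_nonneg)

lemma nbhd_occ_le_occ: "nbhd_occ n x E i \<le> occ n x i"
  unfolding nbhd_occ_def occ_def by (intro divide_right_mono sum_mono) auto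

lemma sum_indicator_le:
  fixes c :: real
  assumes "finite I" "0 \<le> c"
  shows "(\<Sum>i\<in>I. of_bool (k = i) * c) \<le> c"
proof -
  have "(\<Sum>i\<in>I. of_bool (k = i) * c) = (\<Sum>i\<in>I. if k = i then c else 0)"
    by (rule sum.cong) auto
  also have "\<dots> \<le> c" using assms by (simp add: sum.delta)
  finally show ?thesis .
qed

context load_balancing
begin

text \<open>
  Each arrival or departure changes at most one \<open>occ n x i\<close> with \<open>i > 0\<close>, by \<open>\<plusminus>1/n\<close>. For an arrival at
  \<open>u\<close> it is the one with \<open>i - 1\<close> equal to the shortest queue in the neighbourhood of \<open>u\<close>. The hypothesis on \<open>w\<close> is a
  second-order Taylor bound: \<open>g\<close> is the derivative, and the quadratic errors, of order \<open>1/n\<^sup>2\<close> for each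
  of the \<open>O(n)\<close> events per unit time, add up to \<open>(rho + 1) * c / n\<close>.
\<close>

lemma drift_separable_le:
  fixes w g :: "nat \<Rightarrow> real \<Rightarrow> real"
  assumes E: "E \<in> set_pmf G" and I: "finite I" "0 \<notin> I" and c: "0 \<le> c"
    and w: "\<And>i y d. w i (y + d) \<le> w i y + g i y * d + c * d\<^sup>2"
  shows "drift n lam mu G D (\<lambda>s. \<Sum>i\<in>I. w i (occ n (fst s) i)) (x, E)
    \<le> (\<Sum>i\<in>I. g i (occ n x i) * (rho * (nbhd_occ n x E (i - 1) - nbhd_occ n x E i)
          - (occ n x i - occ n x (i + 1)))) + (rho + 1) * c / real n"
proof -
  define f where "f x = (\<Sum>i\<in>I. w i (occ n x i))" for x
  define g' where "g' i = g i (occ n x i)" for i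
  define N where "N u i = (of_bool (\<forall>w\<in>insert u (E `` {u}). i \<le> x w) :: real)" for u i
  have I1: "1 \<le> i" if "i \<in> I" for i using that I(2) by (cases i) auto
  have step: "f y - f x \<le> (\<Sum>i\<in>I. of_bool (k = i) * (\<sigma> * g' i / real n)) + c / (real n)\<^sup>2"
    if \<sigma>: "\<sigma>\<^sup>2 = 1" and y: "\<And>i. i \<in> I \<Longrightarrow> occ n y i = occ n x i + \<sigma> * of_bool (k = i) / real n"
    for y k \<sigma>
  proof -
    have "f y - f x = (\<Sum>i\<in>I. w i (occ n x i + \<sigma> * of_bool (k = i) / real n) - w i (occ n x i))"
      by (simp add: f_def y sum_subtractf)
    also have "\<dots> \<le> (\<Sum>i\<in>I. of_bool (k = i) * (\<sigma> * g' i / real n) + of_bool (k = i) * (c / (real n)\<^sup>2))"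
    proof (rule sum_mono)
      fix i assume "i \<in> I"
      show "w i (occ n x i + \<sigma> * of_bool (k = i) / real n) - w i (occ n x i)
          \<le> of_bool (k = i) * (\<sigma> * g' i / real n) + of_bool (k = i) * (c / (real n)\<^sup>2)"
        using w[of i "occ n x i" "\<sigma> / real n"] \<sigma>
        by (cases "k = i") (auto simp: g'_def power_divide algebra_simps)
    qed
    also have "\<dots> \<le> (\<Sum>i\<in>I. of_bool (k = i) * (\<sigma> * g' i / real n)) + c / (real n)\<^sup>2"
      unfolding sum.distrib using I c by (intro add_mono sum_indicator_le) auto
    finally show ?thesis .
  qed
  have arr: "(\<integral>v. f (x(v := x v + 1)) \<partial>D (x, E) u) - f x
      \<le> (\<Sum>i\<in>I. (N u (i - 1) - N u i) * (g' i / real n)) + c / (real n)\<^sup>2"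
    if u: "u \<in> {1..n}" for u
  proof -
    have "(\<integral>v. f (x(v := x v + 1)) \<partial>D (x, E) u)
        \<le> (\<integral>v. f x + ((\<Sum>i\<in>I. (N u (i - 1) - N u i) * (g' i / real n)) + c / (real n)\<^sup>2) \<partial>D (x, E) u)"
    proof (rule integral_pmf_mono[OF integrable_dispatch[OF E u] integrable_dispatch[OF E u]])
      fix v assume v: "v \<in> set_pmf (D (x, E) u)"
      note v' = dispatch_support[OF E u v]
      have N: "of_bool (Suc (x v) = i) = N u (i - 1) - N u i" if "i \<in> I" for i
      proof -
        \<comment> \<open>the chosen server attains the minimum over the neighbourhood\<close>
        have *: "N u j = of_bool (j \<le> x v)" for j
          unfolding N_def using v'(2,3) order_trans by (intro arg_cong[where f=of_bool]) blast
        show ?thesis unfolding * using I1[OF that] by auto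
      qed
      have "f (x(v := x v + 1)) - f x
          \<le> (\<Sum>i\<in>I. of_bool (Suc (x v) = i) * (1 * g' i / real n)) + c / (real n)\<^sup>2"
        by (rule step) (use occ_arrival[OF v'(1) I1] in auto)
      also have "(\<Sum>i\<in>I. of_bool (Suc (x v) = i) * (1 * g' i / real n))
          = (\<Sum>i\<in>I. (N u (i - 1) - N u i) * (g' i / real n))"
        by (intro sum.cong) (auto simp: N)
      finally show "f (x(v := x v + 1))
          \<le> f x + ((\<Sum>i\<in>I. (N u (i - 1) - N u i) * (g' i / real n)) + c / (real n)\<^sup>2)" by linarith
    qed
    then show ?thesis by simp
  qed
  have dep: "f (x(u := x u - 1)) - f x
      \<le> (\<Sum>i\<in>I. (of_bool (i \<le> x u) - of_bool (i + 1 \<le> x u)) * (- g' i / real n)) + c / (real n)\<^sup>2"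
    if u: "u \<in> {1..n}" for u
  proof -
    have "f (x(u := x u - 1)) - f x
        \<le> (\<Sum>i\<in>I. of_bool (x u = i) * (- 1 * g' i / real n)) + c / (real n)\<^sup>2"
      by (rule step) (use occ_departure[OF u I1] in auto)
    also have "(\<Sum>i\<in>I. of_bool (x u = i) * (- 1 * g' i / real n))
        = (\<Sum>i\<in>I. (of_bool (i \<le> x u) - of_bool (i + 1 \<le> x u)) * (- g' i / real n))"
      by (intro sum.cong) auto
    finally show ?thesis .
  qed
  have swap: "(\<Sum>u\<in>{1..n}. (\<Sum>i\<in>I. (a u i - b u i) * (h i / real n)) + c / (real n)\<^sup>2)
      = (\<Sum>i\<in>I. h i * ((\<Sum>u\<in>{1..n}. a u i) / real n - (\<Sum>u\<in>{1..n}. b u i) / real n)) + c / real n"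
    for a b :: "nat \<Rightarrow> nat \<Rightarrow> real" and h
  proof -
    have "(\<Sum>u\<in>{1..n}. \<Sum>i\<in>I. (a u i - b u i) * (h i / real n))
        = (\<Sum>i\<in>I. \<Sum>u\<in>{1..n}. (a u i - b u i) * (h i / real n))" by (rule sum.swap)
    also have "\<dots> = (\<Sum>i\<in>I. h i * ((\<Sum>u\<in>{1..n}. a u i) / real n - (\<Sum>u\<in>{1..n}. b u i) / real n))"
      unfolding sum_distrib_right[symmetric] sum_subtractf diff_divide_distrib[symmetric]
      by (simp add: mult.commute)
    finally show ?thesis using n_pos by (simp add: sum.distrib power2_eq_square)
  qed
  have "drift n lam mu G D (\<lambda>s. \<Sum>i\<in>I. w i (occ n (fst s) i)) (x, E)
      = rho * (\<Sum>u\<in>{1..n}. (\<integral>v. f (x(v := x v + 1)) \<partial>D (x, E) u) - f x)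
        + (\<Sum>u\<in>{1..n}. f (x(u := x u - 1)) - f x)"
    unfolding drift_eq fst_conv f_def[symmetric] by simp
  also have "\<dots> \<le> rho * (\<Sum>u\<in>{1..n}. (\<Sum>i\<in>I. (N u (i - 1) - N u i) * (g' i / real n)) + c / (real n)\<^sup>2)
        + (\<Sum>u\<in>{1..n}. (\<Sum>i\<in>I. (of_bool (i \<le> x u) - of_bool (i + 1 \<le> x u)) * (- g' i / real n)) + c / (real n)\<^sup>2)"
    using rho_pos by (intro add_mono mult_left_mono sum_mono arr dep) auto
  also have "\<dots> = rho * ((\<Sum>i\<in>I. g' i * (nbhd_occ n x E (i - 1) - nbhd_occ n x E i)) + c / real n)
        + ((\<Sum>i\<in>I. - g' i * (occ n x i - occ n x (i + 1))) + c / real n)"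
    unfolding swap by (simp add: N_def nbhd_occ_def occ_def)
  also have "\<dots> = (\<Sum>i\<in>I. g' i * (rho * (nbhd_occ n x E (i - 1) - nbhd_occ n x E i)
          - (occ n x i - occ n x (i + 1)))) + (rho + 1) * c / real n"
  proof -
    have "(\<Sum>i\<in>I. g' i * (rho * a i - b i)) = rho * (\<Sum>i\<in>I. g' i * a i) + (\<Sum>i\<in>I. - g' i * b i)"
      for a b
      unfolding sum_distrib_left sum.distrib[symmetric] by (intro sum.cong) (simp_all add: algebra_simps)
    then show ?thesis by (simp only: distrib_left distrib_right mult_1_left add_divide_distrib times_divide_eq_right)
  qed
  finally show ?thesis by (simp add: g'_def)
qed

end

section \<open>Fast resampling averages the graph\<close>

definition nbhd_occ_mean :: "nat \<Rightarrow> nat rel pmf \<Rightarrow> (nat \<Rightarrow> nat) \<Rightarrow> nat \<Rightarrow> real" where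
  "nbhd_occ_mean n G x i = (\<integral>E. nbhd_occ n x E i \<partial>G)"

lemma nbhd_occ_bounded: "\<bar>nbhd_occ n x E i\<bar> \<le> 1"
  using nbhd_occ_nonneg[of n x E i] nbhd_occ_le_occ[of n x E i] occ_le_1[of n x i] by linarith

lemma nbhd_occ_mean_nonneg: "0 \<le> nbhd_occ_mean n G x i"
  unfolding nbhd_occ_mean_def by (rule Bochner_Integration.integral_nonneg) (simp add: nbhd_occ_nonneg)

lemma nbhd_occ_mean_le_1: "nbhd_occ_mean n G x i \<le> 1"
  unfolding nbhd_occ_mean_def
  using integral_pmf_bounded[of G "\<lambda>E. nbhd_occ n x E i" 1] nbhd_occ_bounded by (simp add: abs_le_iff)

context load_balancing
begin

text \<open>
  Only the servers with an edge to \<open>v\<close>, and \<open>v\<close> itself, can notice a change of the queue at \<open>v\<close>.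
\<close>

lemma nbhd_occ_fun_upd_le:
  assumes E: "E \<in> set_pmf G" and v: "v \<in> {1..n}"
  shows "\<bar>nbhd_occ n (x(v := a)) E i - nbhd_occ n x E i\<bar> \<le> (dm + 1) / real n"
proof -
  define I where "I y u = (of_bool (\<forall>w\<in>insert u (E `` {u}). i \<le> y w) :: real)" for y :: "nat \<Rightarrow> nat" and u
  have sub: "E\<inverse> `` {v} \<subseteq> {1..n}" using graph[OF E] by (auto simp: simple_digraph_def)
  then have fin: "finite (E\<inverse> `` {v})" by (rule finite_subset) simp
  have "\<bar>(\<Sum>u\<in>{1..n}. I (x(v := a)) u) - (\<Sum>u\<in>{1..n}. I x u)\<bar> \<le> (\<Sum>u\<in>{1..n}. \<bar>I (x(v := a)) u - I x u\<bar>)"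
    unfolding sum_subtractf[symmetric] by (rule sum_abs)
  also have "\<dots> \<le> (\<Sum>u\<in>{1..n}. of_bool (u \<in> insert v (E\<inverse> `` {v})))"
  proof (rule sum_mono)
    fix u
    show "\<bar>I (x(v := a)) u - I x u\<bar> \<le> of_bool (u \<in> insert v (E\<inverse> `` {v}))"
    proof (cases "u \<in> insert v (E\<inverse> `` {v})")
      case False
      then have "I (x(v := a)) u = I x u" by (auto simp: I_def intro!: arg_cong[where f=of_bool])
      then show ?thesis by simp
    qed (simp add: I_def)
  qed
  also have "\<dots> = real (card ({1..n} \<inter> insert v (E\<inverse> `` {v})))"
    by (subst sum_of_bool_eq) (simp_all only: finite_atLeastAtMost Collect_mem_eq)
  also have "\<dots> \<le> real (card (insert v (E\<inverse> `` {v})))"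
    using fin by (intro of_nat_mono card_mono) auto
  also have "\<dots> \<le> real (indegree E v) + 1"
    using fin by (simp add: indegree_def card_insert_if)
  also have "\<dots> \<le> dm + 1" using indeg[OF E v] by simp
  finally have "\<bar>(\<Sum>u\<in>{1..n}. I (x(v := a)) u) - (\<Sum>u\<in>{1..n}. I x u)\<bar> / real n \<le> (dm + 1) / real n"
    by (intro divide_right_mono) auto
  then show ?thesis unfolding nbhd_occ_def I_def[symmetric] by (simp add: diff_divide_distrib[symmetric] del: fun_upd_apply)
qed

lemma nbhd_occ_mean_fun_upd_le:
  assumes v: "v \<in> {1..n}"
  shows "\<bar>nbhd_occ_mean n G (x(v := a)) i - nbhd_occ_mean n G x i\<bar> \<le> (dm + 1) / real n"
proof -
  have "nbhd_occ_mean n G (x(v := a)) i - nbhd_occ_mean n G x i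
      = (\<integral>E. nbhd_occ n (x(v := a)) E i - nbhd_occ n x E i \<partial>G)"
    unfolding nbhd_occ_mean_def
    by (rule Bochner_Integration.integral_diff[symmetric])
       (auto intro!: integrable_pmf_bounded[of _ _ 1] nbhd_occ_bounded)
  also have "\<bar>\<dots>\<bar> \<le> (dm + 1) / real n"
    by (intro integral_pmf_bounded nbhd_occ_fun_upd_le v)
  finally show ?thesis .
qed

text \<open>
  The test function is \<open>F (nbhd_occ - nbhd_occ_mean)\<close>. Resampling contributes exactly \<open>-mu\<close> times
  the function itself to its drift, as its mean over an independent graph is \<open>0\<close>. Each of the other events
  changes it by at most \<open>(L + 2 * (dm + 1)) / n\<close>, and these occur at total rate \<open>(rho + 1) * n\<close>. Since the
  mean drift vanishes, the two contributions balance.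
\<close>

lemma graph_averaging:
  fixes F :: "(nat \<Rightarrow> nat) \<Rightarrow> real"
  assumes F: "\<And>x. \<bar>F x\<bar> \<le> 1"
    and up: "\<And>x v. v \<in> {1..n} \<Longrightarrow> \<bar>F (x(v := x v + 1)) - F x\<bar> \<le> L / real n"
    and down: "\<And>x v. v \<in> {1..n} \<Longrightarrow> \<bar>F (x(v := x v - 1)) - F x\<bar> \<le> L / real n"
  shows "\<bar>\<integral>s. F (fst s) * (nbhd_occ n (fst s) (snd s) i - nbhd_occ_mean n G (fst s) i) \<partial>\<pi>\<bar>
    \<le> (rho + 1) * (L + 2 * (dm + 1)) / mu"
proof -
  define h where "h x E = nbhd_occ n x E i - nbhd_occ_mean n G x i" for x E
  define f where "f s = F (fst s) * h (fst s) (snd s)" for s :: state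
  define c where "c = (L + 2 * (dm + 1)) / real n"
  have h1: "\<bar>h x E\<bar> \<le> 1" for x E
    using nbhd_occ_mean_nonneg[of n G x i] nbhd_occ_mean_le_1[of n G x i] nbhd_occ_nonneg[of n x E i]
      nbhd_occ_bounded[of n x E i] unfolding h_def by linarith
  have f1: "\<bar>f s\<bar> \<le> 1" for s
    using mult_mono[OF F[of "fst s"] h1[of "fst s" "snd s"]] by (simp add: f_def abs_mult)
  have step: "\<bar>f (x(v := a), E) - f (x, E)\<bar> \<le> c"
    if E: "E \<in> set_pmf G" and v: "v \<in> {1..n}" and Fs: "\<bar>F (x(v := a)) - F x\<bar> \<le> L / real n"
    for x v a E
  proof -
    have "f (x(v := a), E) - f (x, E)
        = (F (x(v := a)) - F x) * h x E + F (x(v := a)) * (h (x(v := a)) E - h x E)"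
      by (simp add: f_def algebra_simps)
    also have "\<bar>\<dots>\<bar> \<le> L / real n * 1 + 1 * (2 * (dm + 1) / real n)"
    proof (rule order_trans[OF abs_triangle_ineq], unfold abs_mult, intro add_mono mult_mono Fs h1 F)
      show "\<bar>h (x(v := a)) E - h x E\<bar> \<le> 2 * (dm + 1) / real n"
        using nbhd_occ_fun_upd_le[OF E v, of x a i] nbhd_occ_mean_fun_upd_le[OF v, of x a i]
        unfolding h_def by (simp add: add_divide_distrib)
      show "0 \<le> L / real n" using Fs by linarith
    qed auto
    finally show ?thesis by (simp add: c_def add_divide_distrib)
  qed
  have drift: "\<bar>drift n lam mu G D f (x, E) + mu * f (x, E)\<bar> \<le> (rho + 1) * (L + 2 * (dm + 1))"
    if E: "E \<in> set_pmf G" for x E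
  proof -
    have up': "\<bar>(\<integral>v. f (x(v := x v + 1), E) \<partial>D (x, E) u) - f (x, E)\<bar> \<le> c" if u: "u \<in> {1..n}" for u
    proof -
      have "(\<integral>v. f (x(v := x v + 1), E) \<partial>D (x, E) u) - f (x, E)
          = (\<integral>v. f (x(v := x v + 1), E) - f (x, E) \<partial>D (x, E) u)"
        by (subst Bochner_Integration.integral_diff) (auto intro!: integrable_dispatch E u)
      also have "\<bar>\<dots>\<bar> \<le> c"
        by (intro integral_pmf_bounded step up E) (use dispatch_support(1)[OF E u] in auto)
      finally show ?thesis .
    qed
    have resample: "(\<integral>E'. f (x, E') \<partial>G) = 0"
    proof -
      have "(\<integral>E'. h x E' \<partial>G) = 0"
        unfolding h_def nbhd_occ_mean_def
        by (subst Bochner_Integration.integral_diff)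
           (auto intro!: integrable_pmf_bounded[of _ _ 1] nbhd_occ_bounded)
      then show ?thesis by (simp add: f_def)
    qed
    have sum_le: "\<bar>\<Sum>u\<in>{1..n}. a u\<bar> \<le> L + 2 * (dm + 1)" if "\<And>u. u \<in> {1..n} \<Longrightarrow> \<bar>a u\<bar> \<le> c" for a :: "nat \<Rightarrow> real"
    proof -
      have "\<bar>\<Sum>u\<in>{1..n}. a u\<bar> \<le> (\<Sum>u\<in>{1..n}. c)"
        by (rule order_trans[OF sum_abs]) (intro sum_mono that)
      then show ?thesis using n_pos by (simp add: c_def)
    qed
    have "drift n lam mu G D f (x, E) + mu * f (x, E)
        = rho * (\<Sum>u\<in>{1..n}. (\<integral>v. f (x(v := x v + 1), E) \<partial>D (x, E) u) - f (x, E)) +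
          (\<Sum>u\<in>{1..n}. f (x(u := x u - 1), E) - f (x, E))"
      unfolding drift_eq resample by simp
    also have "\<bar>\<dots>\<bar> \<le> rho * (L + 2 * (dm + 1)) + (L + 2 * (dm + 1))"
    proof (rule order_trans[OF abs_triangle_ineq], unfold abs_mult, intro add_mono mult_mono sum_le up' step down E)
      show "\<bar>rho\<bar> \<le> rho" using rho_pos by simp
    qed (use rho_pos in auto)
    finally show ?thesis by (simp add: algebra_simps)
  qed
  have int: "integrable \<pi> f" using f1 by (rule integrable_pmf_bounded)
  have "mu * (\<integral>s. f s \<partial>\<pi>) = (\<integral>s. drift n lam mu G D f s + mu * f s \<partial>\<pi>)"
    using stationary_drift[of f 1] f1 int by simp
  also have "\<bar>\<dots>\<bar> \<le> (rho + 1) * (L + 2 * (dm + 1))"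
    using drift stationary_graph by (intro integral_pmf_bounded) auto
  finally show ?thesis using mu unfolding f_def h_def by (simp add: abs_mult field_simps)
qed

section \<open>Geometric decay of the occupancies\<close>

lemma occ_tendsto_0: "(\<lambda>i. \<integral>s. occ n (fst s) i \<partial>\<pi>) \<longlonglongrightarrow> 0"
proof -
  have "(\<lambda>i. occ n x i) \<longlonglongrightarrow> 0" for x
  proof (rule tendsto_eventually, unfold eventually_sequentially, intro exI allI impI)
    fix i assume i: "Suc (\<Sum>u\<in>{1..n}. x u) \<le> i"
    have "\<not> i \<le> x u" if "u \<in> {1..n}" for u
      using i member_le_sum[OF that, of x] by simp
    then show "occ n x i = 0" by (simp add: occ_def)
  qed
  then have "(\<lambda>i. \<integral>s. occ n (fst s) i \<partial>\<pi>) \<longlonglongrightarrow> (\<integral>s. 0 \<partial>\<pi>)"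
    by (intro integral_dominated_convergence[where w="\<lambda>_. 1"])
       (auto simp: occ_nonneg occ_le_1)
  then show ?thesis by simp
qed

lemma integrable_occ: "integrable \<pi> (\<lambda>s. occ n (fst s) i)"
  by (rule integrable_pmf_bounded[of _ _ 1]) (simp add: occ_nonneg occ_le_1)

lemma integrable_nbhd_occ: "integrable \<pi> (\<lambda>s. nbhd_occ n (fst s) (snd s) i)"
  by (rule integrable_pmf_bounded[of _ _ 1]) (rule nbhd_occ_bounded)

text \<open>
  In equilibrium, tasks enter and leave the queues at positions above \<open>k\<close> at the same rate:
  the former is \<open>rho\<close> times the mean of \<open>nbhd_occ\<close> at level \<open>k\<close>, and \<open>nbhd_occ\<close> is at most \<open>occ\<close>. The sum of all
  occupancies above \<open>k\<close> is unbounded, so it is truncated at \<open>m\<close>, which costs the term at level \<open>m + 1\<close>.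
\<close>

lemma occ_decay_step: "(\<integral>s. occ n (fst s) (Suc k) \<partial>\<pi>) \<le> rho * (\<integral>s. occ n (fst s) k \<partial>\<pi>)"
proof -
  let ?q = "\<lambda>i. \<integral>s. occ n (fst s) i \<partial>\<pi>"
  have "?q (Suc k) \<le> rho * ?q k + ?q (Suc m)" if m: "Suc k \<le> m" for m
  proof -
    let ?f = "\<lambda>s :: state. \<Sum>i\<in>{Suc k..m}. occ n (fst s) i"
    have bd: "\<bar>?f s\<bar> \<le> (\<Sum>i\<in>{Suc k..m}. 1)" for s
      by (rule order_trans[OF sum_abs]) (intro sum_mono, simp add: occ_nonneg occ_le_1)
    have tele: "(\<Sum>i\<in>{Suc k..m}. a (i - 1) - a i) = a k - a m"
      "(\<Sum>i\<in>{Suc k..m}. a i - a (i + 1)) = a (Suc k) - a (Suc m)" for a :: "nat \<Rightarrow> real"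
      using m by (induction m rule: dec_induct) auto
    have le: "drift n lam mu G D ?f s
        \<le> rho * nbhd_occ n (fst s) (snd s) k - (occ n (fst s) (Suc k) - occ n (fst s) (Suc m))"
      if "s \<in> set_pmf \<pi>" for s
    proof -
      obtain x E where s: "s = (x, E)" by (cases s)
      have "drift n lam mu G D ?f (x, E) \<le> (\<Sum>i\<in>{Suc k..m}. 1 * (rho * (nbhd_occ n x E (i - 1) - nbhd_occ n x E i)
          - (occ n x i - occ n x (i + 1)))) + (rho + 1) * 0 / real n"
        using drift_separable_le[of E "{Suc k..m}" 0 "\<lambda>_ y. y" "\<lambda>_ _. 1" x]
          stationary_graph that s by simp
      also have "\<dots> = rho * (nbhd_occ n x E k - nbhd_occ n x E m) - (occ n x (Suc k) - occ n x (Suc m))"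
        unfolding tele[symmetric] sum_distrib_left sum_subtractf[symmetric] by simp
      also have "\<dots> \<le> rho * nbhd_occ n x E k - (occ n x (Suc k) - occ n x (Suc m))"
        using mult_nonneg_nonneg[OF less_imp_le[OF rho_pos] nbhd_occ_nonneg[of n x E m]]
        by (simp add: algebra_simps)
      finally show ?thesis by (simp add: s)
    qed
    have "0 = (\<integral>s. drift n lam mu G D ?f s \<partial>\<pi>)"
      using stationary_drift(1)[of ?f, OF bd] by simp
    also have "\<dots> \<le> (\<integral>s. rho * nbhd_occ n (fst s) (snd s) k - (occ n (fst s) (Suc k) - occ n (fst s) (Suc m)) \<partial>\<pi>)"
      using stationary_drift(2)[of ?f, OF bd] integrable_nbhd_occ integrable_occ le
      by (intro integral_pmf_mono) auto
    also have "\<dots> = rho * (\<integral>s. nbhd_occ n (fst s) (snd s) k \<partial>\<pi>) - (?q (Suc k) - ?q (Suc m))"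
      using integrable_nbhd_occ integrable_occ by simp
    also have "\<dots> \<le> rho * ?q k - (?q (Suc k) - ?q (Suc m))"
      using rho_pos
      by (intro diff_right_mono mult_left_mono integral_pmf_mono integrable_nbhd_occ integrable_occ
          nbhd_occ_le_occ) auto
    finally show ?thesis by simp
  qed
  then have ev: "\<exists>N. \<forall>m\<ge>N. ?q (Suc k) \<le> rho * ?q k + ?q (Suc m)" by blast
  have "(\<lambda>m. rho * ?q k + ?q (Suc m)) \<longlonglongrightarrow> rho * ?q k + 0"
    by (intro tendsto_intros LIMSEQ_Suc occ_tendsto_0)
  from LIMSEQ_le_const[OF this ev] show ?thesis by simp
qed

lemma occ_decay: "(\<integral>s. occ n (fst s) k \<partial>\<pi>) \<le> rho ^ k"
proof (induction k)
  case 0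
  show ?case using n_pos by (simp add: occ_def)
next
  case (Suc k)
  have "rho * (\<integral>s. occ n (fst s) k \<partial>\<pi>) \<le> rho * rho ^ k"
    using Suc rho_pos by (intro mult_left_mono) auto
  then show ?case using occ_decay_step[of k] by simp
qed

end

section \<open>Permutation invariant graphs\<close>

lemma ex_permutes_image:
  assumes V: "finite V" and A: "A \<subseteq> V" "B \<subseteq> V" and card: "card A = card B"
  obtains \<sigma> where "\<sigma> permutes V" "\<sigma> ` A = B"
proof -
  have fin: "finite A" "finite B" using A V finite_subset by auto
  obtain f where f: "bij_betw f A B"
    using finite_same_card_bij[OF fin card] by blast
  have "card (V - A) = card (V - B)" using A fin card by (simp add: card_Diff_subset)
  then obtain g where g: "bij_betw g (V - A) (V - B)"
    using finite_same_card_bij[of "V - A" "V - B"] V by blast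
  define \<sigma> where "\<sigma> u = (if u \<in> V then if u \<in> A then f u else g u else u)" for u
  have sA: "bij_betw \<sigma> A B"
    using f A by (subst bij_betw_cong[of _ _ f]) (auto simp: \<sigma>_def)
  have sB: "bij_betw \<sigma> (V - A) (V - B)"
    using g A by (subst bij_betw_cong[of _ _ g]) (auto simp: \<sigma>_def)
  have "bij_betw \<sigma> (A \<union> (V - A)) (B \<union> (V - B))"
    by (rule bij_betw_combine[OF sA sB]) auto
  then have "bij_betw \<sigma> V V" using A by (simp add: Un_absorb1)
  then have "\<sigma> permutes V" by (rule bij_imp_permutes) (simp add: \<sigma>_def)
  moreover have "\<sigma> ` A = B" using sA by (simp add: bij_betw_def)
  ultimately show ?thesis by (rule that)
qed

text \<open>
  A double count of pairs \<open>T \<subseteq> A \<subseteq> V\<close>, kept in product form so that it also holds in the degenerate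
  cases where a binomial coefficient vanishes.
\<close>

lemma card_supersets:
  assumes V: "finite V" and T: "T \<subseteq> V"
  shows "real (card {A. A \<subseteq> V \<and> card A = a \<and> T \<subseteq> A}) * real (card V choose card T)
       = real (card V choose a) * real (a choose card T)"
proof (cases "card T \<le> a")
  case True
  have fT: "finite T" using T V finite_subset by auto
  have "bij_betw (\<lambda>B. T \<union> B) {B. B \<subseteq> V - T \<and> card B = a - card T} {A. A \<subseteq> V \<and> card A = a \<and> T \<subseteq> A}"
  proof (rule bij_betwI[where g="\<lambda>A. A - T"])
    show "(\<lambda>B. T \<union> B) \<in> {B. B \<subseteq> V - T \<and> card B = a - card T} \<rightarrow> {A. A \<subseteq> V \<and> card A = a \<and> T \<subseteq> A}"
    proof
      fix B assume B: "B \<in> {B. B \<subseteq> V - T \<and> card B = a - card T}"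
      then have "finite B" using V finite_subset[of B V] by auto
      then have "card (T \<union> B) = card T + card B" using B fT by (intro card_Un_disjoint) auto
      then show "T \<union> B \<in> {A. A \<subseteq> V \<and> card A = a \<and> T \<subseteq> A}" using B T True by auto
    qed
  qed (use fT in \<open>auto simp: card_Diff_subset\<close>)
  from bij_betw_same_card[OF this]
  have "card {A. A \<subseteq> V \<and> card A = a \<and> T \<subseteq> A} = card (V - T) choose (a - card T)"
    using n_subsets[of "V - T" "a - card T"] V by simp
  also have "\<dots> = (card V - card T) choose (a - card T)" using fT T by (simp add: card_Diff_subset)
  finally have eq: "card {A. A \<subseteq> V \<and> card A = a \<and> T \<subseteq> A} = (card V - card T) choose (a - card T)" .
  show ?thesis
  proof (cases "a \<le> card V")
    case True
    then show ?thesis unfolding eq of_nat_mult[symmetric]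
      using choose_mult[OF \<open>card T \<le> a\<close> True] by (simp add: mult.commute)
  next
    case False
    then show ?thesis unfolding eq using \<open>card T \<le> a\<close> card_mono[OF V T] by (simp add: binomial_eq_0)
  qed
next
  case False
  have empty: "{A. A \<subseteq> V \<and> card A = a \<and> T \<subseteq> A} = {}"
    using False V by (auto dest: card_mono[OF finite_subset])
  show ?thesis unfolding empty using False by (simp add: binomial_eq_0)
qed

text \<open>
  The probability that a uniformly random set of \<open>m\<close> out of \<open>n\<close> elements is contained in a given
  set of size \<open>a\<close>.
\<close>

definition choose_ratio :: "nat \<Rightarrow> nat \<Rightarrow> nat \<Rightarrow> real" where
  "choose_ratio a n m = real (a choose m) / real (n choose m)"

lemma choose_ratio_Suc:
  "choose_ratio a n (Suc m) = choose_ratio a n m * (real (a - m) / real (n - m))"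
proof -
  have *: "Suc m * (a choose Suc m) = (a - m) * (a choose m)" for a
    by (cases a) (simp_all only: binomial_absorption binomial_absorb_comp diff_Suc_1 binomial_0_Suc diff_0_eq_0 mult_0 mult_0_right)
  have "choose_ratio a n (Suc m) = real (Suc m * (a choose Suc m)) / real (Suc m * (n choose Suc m))"
    by (simp add: choose_ratio_def del: binomial_Suc_Suc of_nat_Suc mult_Suc)
  then show ?thesis unfolding * by (simp add: choose_ratio_def mult.commute)
qed

lemma choose_ratio_bounds: "a \<le> n \<Longrightarrow> 0 \<le> choose_ratio a n m \<and> choose_ratio a n m \<le> 1"
proof (induction m)
  case (Suc m)
  then have "0 \<le> real (a - m) / real (n - m)" "real (a - m) / real (n - m) \<le> 1"
    by (auto simp: divide_le_eq)
  then show ?case unfolding choose_ratio_Suc using Suc by (auto intro!: mult_nonneg_nonneg mult_le_one simp del: times_divide_eq_right)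
qed (simp add: choose_ratio_def)

text \<open>
  Sampling without replacement is close to sampling with replacement, uniformly in \<open>a\<close>: the
  factors \<open>(a - k) / (n - k)\<close> and \<open>a / n\<close> differ by at most \<open>k / n\<close>.
\<close>

lemma choose_ratio_approx:
  assumes "a \<le> n" "1 \<le> n"
  shows "\<bar>choose_ratio a n m - (real a / real n) ^ m\<bar> \<le> real m * real m / real n"
proof (induction m)
  case (Suc m)
  let ?y = "real a / real n" and ?z = "real (a - m) / real (n - m)"
  have y: "0 \<le> ?y" "?y \<le> 1" using assms by auto
  have z: "\<bar>?z - ?y\<bar> \<le> real m / real n"
  proof (cases "m \<le> a \<and> m < n")
    case True
    then have "?z - ?y = - (real m / real n * (real (n - a) / real (n - m)))"
      using assms by (simp add: of_nat_diff divide_simps) (simp add: algebra_simps)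
    also have "\<bar>\<dots>\<bar> \<le> real m / real n * 1"
      unfolding abs_minus_cancel abs_mult using True
      by (intro mult_mono) (auto simp: divide_le_eq)
    finally show ?thesis by simp
  next
    case False
    then have "?z = 0" "a \<le> m" using assms by auto
    then show ?thesis using assms by (simp add: divide_right_mono)
  qed
  have "choose_ratio a n (Suc m) - ?y ^ Suc m
      = choose_ratio a n m * (?z - ?y) + (choose_ratio a n m - ?y ^ m) * ?y"
    unfolding choose_ratio_Suc by (simp add: algebra_simps)
  also have "\<bar>\<dots>\<bar> \<le> 1 * (real m / real n) + (real m * real m / real n) * 1"
  proof (rule order_trans[OF abs_triangle_ineq], unfold abs_mult, intro add_mono mult_mono z Suc)
    show "\<bar>choose_ratio a n m\<bar> \<le> 1" using choose_ratio_bounds[OF assms(1), of m] by simp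
  qed (use y in auto)
  also have "\<dots> \<le> real (Suc m) * real (Suc m) / real n"
    by (simp add: add_divide_distrib[symmetric] divide_right_mono algebra_simps)
  finally show ?case .
qed (simp add: choose_ratio_def)

lemma integral_outdegree_pmf:
  fixes g :: "nat \<Rightarrow> real"
  assumes n: "1 \<le> n" and g: "\<And>d. \<bar>g d\<bar> \<le> B"
  shows "(\<integral>d. g d \<partial>outdegree_pmf n G) = (\<integral>E. (\<Sum>u\<in>{1..n}. g (outdegree E u)) / real n \<partial>G)"
proof -
  have "(\<integral>d. g d \<partial>outdegree_pmf n G)
      = (\<integral>E. (\<integral>d. g d \<partial>bind_pmf (pmf_of_set {1..n}) (\<lambda>u. return_pmf (outdegree E u))) \<partial>G)"
    unfolding outdegree_pmf_def by (rule integral_bind_pmf_bounded[where f=g, OF g])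
  also have "(\<lambda>E. \<integral>d. g d \<partial>bind_pmf (pmf_of_set {1..n}) (\<lambda>u. return_pmf (outdegree E u)))
      = (\<lambda>E. (\<Sum>u\<in>{1..n}. g (outdegree E u)) / real n)"
    unfolding integral_bind_pmf_bounded[where f=g, OF g]
    using n by (auto simp: integral_pmf_of_set)
  finally show ?thesis .
qed

text \<open>
  By invariance the left-hand side takes the same value on all sets with as many elements as \<open>A\<close>, so it
  equals its average over all of these sets. Averaging over the sets first, with the graph fixed, leaves
  a quantity that only depends on the size of the neighbourhood.
\<close>

lemma permutation_invariant_mean:
  fixes n :: nat and G :: "nat rel pmf"
  assumes n: "1 \<le> n" and graph: "\<And>E. E \<in> set_pmf G \<Longrightarrow> simple_digraph n E"
    and perm: "permutation_invariant n G" and A: "A \<subseteq> {1..n}"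
  shows "(\<integral>E. (\<Sum>u\<in>{1..n}. of_bool (insert u (E `` {u}) \<subseteq> A)) / real n \<partial>G)
       = (\<integral>d. choose_ratio (card A) n (Suc d) \<partial>outdegree_pmf n G)"
proof -
  define N where "N E u = insert u (E `` {u})" for E :: "nat rel" and u
  define h where "h A = (\<integral>E. (\<Sum>u\<in>{1..n}. of_bool (N E u \<subseteq> A)) / real n \<partial>G)" for A
  let ?a = "card A"
  define \<A> where "\<A> = {B. B \<subseteq> {1..n} \<and> card B = ?a}"
  have a: "?a \<le> n" using card_mono[OF _ A] by simp
  have inv: "h B = h A" if B: "B \<in> \<A>" for B
  proof -
    obtain \<sigma> where \<sigma>: "\<sigma> permutes {1..n}" and im: "\<sigma> ` A = B"
      by (rule ex_permutes_image[of "{1..n}" A B]) (use B A in \<open>auto simp: \<A>_def\<close>)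
    have inj: "inj \<sigma>" using \<sigma> by (rule permutes_inj)
    have N: "N (map_prod \<sigma> \<sigma> ` E) (\<sigma> u) = \<sigma> ` N E u" for E u
      using inj by (auto simp: N_def image_iff inj_def Bex_def) 
    have "h B = (\<integral>E. (\<Sum>u\<in>{1..n}. of_bool (N E u \<subseteq> B)) / real n \<partial>map_pmf (\<lambda>E. map_prod \<sigma> \<sigma> ` E) G)"
      using perm \<sigma> unfolding h_def permutation_invariant_def by simp
    also have "\<dots> = (\<integral>E. (\<Sum>u\<in>{1..n}. of_bool (N (map_prod \<sigma> \<sigma> ` E) u \<subseteq> B)) / real n \<partial>G)"
      by simp
    also have "(\<lambda>E. \<Sum>u\<in>{1..n}. of_bool (N (map_prod \<sigma> \<sigma> ` E) u \<subseteq> B))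
        = (\<lambda>E. \<Sum>u\<in>{1..n}. of_bool (N (map_prod \<sigma> \<sigma> ` E) (\<sigma> u) \<subseteq> B) :: real)"
      by (rule ext, rule sum.permute[OF \<sigma>, unfolded o_def])
    also have "\<dots> = (\<lambda>E. \<Sum>u\<in>{1..n}. of_bool (N E u \<subseteq> A))"
      unfolding N im[symmetric] by (simp add: inj_image_subset_iff[OF inj])
    finally show ?thesis by (simp add: h_def)
  qed
  have count: "(\<Sum>B\<in>\<A>. of_bool (N E u \<subseteq> B)) = real (n choose ?a) * choose_ratio ?a n (Suc (outdegree E u))"
    if E: "E \<in> set_pmf G" and u: "u \<in> {1..n}" for E u
  proof -
    have sub: "N E u \<subseteq> {1..n}" using graph[OF E] u by (auto simp: simple_digraph_def N_def)
    have "finite (E `` {u})" using sub finite_subset[of "E `` {u}" "{1..n}"] by (auto simp: N_def)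
    moreover have "u \<notin> E `` {u}" using graph[OF E] by (auto simp: simple_digraph_def irrefl_def)
    ultimately have cardN: "card (N E u) = Suc (outdegree E u)" by (simp add: N_def outdegree_def)
    have "card (N E u) \<le> n" using card_mono[OF _ sub] by simp
    then have pos: "0 < n choose card (N E u)" by simp
    have "(\<Sum>B\<in>\<A>. of_bool (N E u \<subseteq> B)) = real (card (\<A> \<inter> {B. N E u \<subseteq> B}))"
      by (rule sum_of_bool_eq, rule finite_subset[of _ "Pow {1..n}"]) (auto simp: \<A>_def)
    also have "\<A> \<inter> {B. N E u \<subseteq> B} = {B. B \<subseteq> {1..n} \<and> card B = ?a \<and> N E u \<subseteq> B}"
      by (auto simp: \<A>_def)
    finally show ?thesis
      using card_supersets[OF _ sub, of ?a] pos cardN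
      by (simp add: choose_ratio_def field_simps del: binomial_Suc_Suc)
  qed
  have int: "integrable G (\<lambda>E. (\<Sum>u\<in>{1..n}. of_bool (N E u \<subseteq> B)) / real n)" for B
  proof (rule integrable_pmf_bounded[of _ _ 1])
    fix E
    have "(\<Sum>u\<in>{1..n}. of_bool (N E u \<subseteq> B) :: real) \<le> (\<Sum>u\<in>{1..n}. 1)" by (intro sum_mono) auto
    then show "\<bar>(\<Sum>u\<in>{1..n}. of_bool (N E u \<subseteq> B)) / real n\<bar> \<le> 1" using n by (simp add: sum_nonneg)
  qed
  have "real (n choose ?a) * h A = (\<Sum>B\<in>\<A>. h B)"
    using n_subsets[of "{1..n}" ?a] by (simp add: inv) (simp add: \<A>_def)
  also have "\<dots> = (\<integral>E. (\<Sum>B\<in>\<A>. (\<Sum>u\<in>{1..n}. of_bool (N E u \<subseteq> B)) / real n) \<partial>G)"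
    unfolding h_def by (rule Bochner_Integration.integral_sum[symmetric]) (rule int)
  also have "\<dots> = (\<integral>E. real (n choose ?a) * ((\<Sum>u\<in>{1..n}. choose_ratio ?a n (Suc (outdegree E u))) / real n) \<partial>G)"
  proof (rule integral_pmf_cong)
    fix E assume E: "E \<in> set_pmf G"
    have "(\<Sum>B\<in>\<A>. (\<Sum>u\<in>{1..n}. of_bool (N E u \<subseteq> B)) / real n)
        = (\<Sum>u\<in>{1..n}. \<Sum>B\<in>\<A>. of_bool (N E u \<subseteq> B)) / real n"
      unfolding sum_divide_distrib[symmetric] by (subst sum.swap) simp
    then show "(\<Sum>B\<in>\<A>. (\<Sum>u\<in>{1..n}. of_bool (N E u \<subseteq> B)) / real n)
        = real (n choose ?a) * ((\<Sum>u\<in>{1..n}. choose_ratio ?a n (Suc (outdegree E u))) / real n)"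
      by (simp add: count[OF E] sum_distrib_left)
  qed
  also have "\<dots> = real (n choose ?a) * (\<integral>d. choose_ratio ?a n (Suc d) \<partial>outdegree_pmf n G)"
    using integral_outdegree_pmf[OF n, of "\<lambda>d. choose_ratio ?a n (Suc d)" 1 G] choose_ratio_bounds[OF a]
    by simp
  finally have "h A = (\<integral>d. choose_ratio ?a n (Suc d) \<partial>outdegree_pmf n G)"
    using a by (subst (asm) mult_cancel_left) auto
  then show ?thesis unfolding h_def N_def .
qed

section \<open>Uniform convergence of the averaged arrival rates\<close>

lemma pmf_tail:
  fixes q :: "nat pmf"
  shows "measure q {M..} = 1 - (\<Sum>d<M. pmf q d)"
proof -
  have "measure q {..<M} = (\<Sum>d<M. pmf q d)" by (simp add: measure_measure_pmf_finite)
  moreover have "measure q {..<M} + measure q {M..} = measure q ({..<M} \<union> {M..})"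
    by (rule measure_pmf.finite_measure_Union[symmetric]) auto
  moreover have "{..<M} \<union> {M..} = UNIV" by auto
  ultimately show ?thesis by simp
qed

lemma expectation_truncation:
  fixes q :: "nat pmf" and g :: "nat \<Rightarrow> real"
  assumes g: "\<And>d. 0 \<le> g d \<and> g d \<le> 1"
  shows "\<bar>(\<integral>d. g d \<partial>q) - (\<Sum>d<M. g d * pmf q d)\<bar> \<le> 1 - (\<Sum>d<M. pmf q d)"
proof -
  have int: "integrable q (\<lambda>d. g d * indicator S d)" for S
    using g by (intro integrable_pmf_bounded[of _ _ 1]) (auto simp: indicator_def)
  have "(\<integral>d. g d \<partial>q) = (\<integral>d. g d * indicator {..<M} d + g d * indicator {M..} d \<partial>q)"
    by (intro integral_pmf_cong) (auto simp: indicator_def)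
  also have "\<dots> = (\<integral>d. g d * indicator {..<M} d \<partial>q) + (\<integral>d. g d * indicator {M..} d \<partial>q)"
    by (rule Bochner_Integration.integral_add) (rule int)+
  also have "(\<integral>d. g d * indicator {..<M} d \<partial>q) = (\<Sum>d<M. g d * indicator {..<M} d * pmf q d)"
    by (rule integral_measure_pmf_real) (auto simp: indicator_def split: if_splits)
  also have "\<dots> = (\<Sum>d<M. g d * pmf q d)" by (intro sum.cong) auto
  finally have eq: "(\<integral>d. g d \<partial>q) - (\<Sum>d<M. g d * pmf q d) = (\<integral>d. g d * indicator {M..} d \<partial>q)" by simp
  have "0 \<le> (\<integral>d. g d * indicator {M..} d \<partial>q)"
    using g by (intro Bochner_Integration.integral_nonneg) auto
  moreover have "(\<integral>d. g d * indicator {M..} d \<partial>q) \<le> (\<integral>d. indicator {M..} d \<partial>q)"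
    using g by (intro integral_pmf_mono int) (auto simp: indicator_def intro!: integrable_pmf_bounded[of _ _ 1])
  ultimately show ?thesis unfolding eq pmf_tail[symmetric] by simp
qed

lemma series_truncation:
  fixes p g :: "nat \<Rightarrow> real"
  assumes g: "\<And>d. 0 \<le> g d \<and> g d \<le> 1" and p: "\<And>d. 0 \<le> p d" "p sums 1"
  shows "summable (\<lambda>d. g d * p d)"
    and "\<bar>(\<Sum>d. g d * p d) - (\<Sum>d<M. g d * p d)\<bar> \<le> 1 - (\<Sum>d<M. p d)"
proof -
  have sp: "summable p" using p(2) sums_summable by blast
  show s: "summable (\<lambda>d. g d * p d)"
    using g p(1) by (intro summable_comparison_test'[OF sp, of 0]) (auto simp: abs_mult mult_left_le_one_le)
  have "(\<Sum>d. g d * p d) - (\<Sum>d<M. g d * p d) = (\<Sum>d. g (d + M) * p (d + M))"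
    using suminf_split_initial_segment[OF s, of M] by simp
  moreover have "0 \<le> (\<Sum>d. g (d + M) * p (d + M))"
    using g p(1) s by (intro suminf_nonneg) (auto intro: summable_ignore_initial_segment)
  moreover have "(\<Sum>d. g (d + M) * p (d + M)) \<le> (\<Sum>d. p (d + M))"
    using g p(1) s sp
    by (intro suminf_le) (auto intro: summable_ignore_initial_segment[where f="\<lambda>d. g d * p d"] summable_ignore_initial_segment mult_left_le_one_le)
  moreover have "(\<Sum>d. p (d + M)) = 1 - (\<Sum>d<M. p d)"
    using suminf_split_initial_segment[OF sp, of M] sums_unique[OF p(2)] by simp
  ultimately show "\<bar>(\<Sum>d. g d * p d) - (\<Sum>d<M. g d * p d)\<bar> \<le> 1 - (\<Sum>d<M. p d)" by simp
qed

text \<open>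
  Pointwise convergence of the outdegree laws to a law without loss of mass is convergence in total
  variation, so outdegrees beyond a large \<open>M\<close> can be neglected uniformly in \<open>n\<close>; below \<open>M\<close>,
  \<open>choose_ratio_approx\<close> applies. Uniformity in \<open>a\<close> matters since \<open>a\<close> becomes the random
  number of servers with at least \<open>i\<close> tasks.
\<close>

lemma choose_ratio_uniform_limit:
  fixes q :: "nat \<Rightarrow> nat pmf" and p :: "nat \<Rightarrow> real"
  assumes p: "\<And>d. 0 \<le> p d" "p sums 1" and lim: "\<And>d. (\<lambda>n. pmf (q n) d) \<longlonglongrightarrow> p d"
  shows "\<exists>\<kappa>. \<kappa> \<longlonglongrightarrow> 0 \<and> (\<forall>n\<ge>1. \<forall>a\<le>n. \<bar>(\<integral>d. choose_ratio a n (Suc d) \<partial>q n)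
      - (\<Sum>d. (real a / real n) ^ Suc d * p d)\<bar> \<le> \<kappa> n)"
proof -
  define err where "err n a = \<bar>(\<integral>d. choose_ratio a n (Suc d) \<partial>q n)
      - (\<Sum>d. (real a / real n) ^ Suc d * p d)\<bar>" for n a
  define \<kappa> where "\<kappa> n = Max (err n ` {..n})" for n
  define bd where "bd M n = (\<Sum>d<M. real (Suc d) * real (Suc d) / real n + \<bar>pmf (q n) d - p d\<bar>)
      + (1 - (\<Sum>d<M. pmf (q n) d)) + (1 - (\<Sum>d<M. p d))" for M n
  have err: "err n a \<le> bd M n" if n: "1 \<le> n" and a: "a \<le> n" for n a M
  proof -
    let ?g = "\<lambda>d. choose_ratio a n (Suc d)" and ?y = "\<lambda>d. (real a / real n) ^ Suc d"
    have g: "0 \<le> ?g d \<and> ?g d \<le> 1" for d using choose_ratio_bounds[OF a] .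
    have y: "0 \<le> ?y d \<and> ?y d \<le> 1" for d using a n by (auto intro!: power_le_one simp del: power_Suc)
    have "\<bar>(\<Sum>d<M. ?g d * pmf (q n) d) - (\<Sum>d<M. ?y d * p d)\<bar>
        \<le> (\<Sum>d<M. \<bar>?g d * pmf (q n) d - ?y d * p d\<bar>)"
      unfolding sum_subtractf[symmetric] by (rule sum_abs)
    also have "\<dots> \<le> (\<Sum>d<M. real (Suc d) * real (Suc d) / real n + \<bar>pmf (q n) d - p d\<bar>)"
    proof (rule sum_mono)
      fix d
      have "?g d * pmf (q n) d - ?y d * p d = (?g d - ?y d) * pmf (q n) d + ?y d * (pmf (q n) d - p d)"
        unfolding left_diff_distrib right_diff_distrib by linarith
      also have "\<bar>\<dots>\<bar> \<le> (real (Suc d) * real (Suc d) / real n) * 1 + 1 * \<bar>pmf (q n) d - p d\<bar>"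
        using y[of d]
        by (intro order_trans[OF abs_triangle_ineq], unfold abs_mult,
            intro add_mono mult_mono choose_ratio_approx a n) (auto simp: pmf_le_1)
      finally show "\<bar>?g d * pmf (q n) d - ?y d * p d\<bar>
          \<le> real (Suc d) * real (Suc d) / real n + \<bar>pmf (q n) d - p d\<bar>" by simp
    qed
    finally show ?thesis
      using expectation_truncation[of ?g "q n" M, OF g] series_truncation(2)[of ?y p M, OF y p]
      unfolding err_def bd_def by linarith
  qed
  have bdlim: "bd M \<longlonglongrightarrow> (\<Sum>d<M. 0 + \<bar>p d - p d\<bar>) + (1 - (\<Sum>d<M. p d)) + (1 - (\<Sum>d<M. p d))" for M
    unfolding bd_def by (intro tendsto_intros lim lim_const_over_n)
  have "\<kappa> \<longlonglongrightarrow> 0"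
  proof (rule LIMSEQ_I)
    fix r :: real assume r: "0 < r"
    have "(\<lambda>M. \<Sum>d<M. p d) \<longlonglongrightarrow> 1" using p(2) by (simp add: sums_def)
    then have "eventually (\<lambda>M. 1 - r / 4 < (\<Sum>d<M. p d)) sequentially"
      using r by (intro order_tendstoD) auto
    then obtain M where M: "1 - r / 4 < (\<Sum>d<M. p d)" by (auto simp: eventually_sequentially)
    have "eventually (\<lambda>n. bd M n < r) sequentially"
      using M r by (intro order_tendstoD(2)[OF bdlim]) simp
    then obtain N where N: "\<And>n. n \<ge> N \<Longrightarrow> bd M n < r" by (auto simp: eventually_sequentially)
    show "\<exists>N. \<forall>n\<ge>N. norm (\<kappa> n - 0) < r"
    proof (intro exI[of _ "max N 1"] allI impI)
      fix n assume n: "max N 1 \<le> n"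
      have "\<kappa> n < r" unfolding \<kappa>_def using err[of n _ M] N[of n] n by (subst Max_less_iff) fastforce+
      moreover have "0 \<le> err n 0" by (simp add: err_def)
      then have "0 \<le> \<kappa> n" unfolding \<kappa>_def by (rule order_trans) (auto intro: Max_ge)
      ultimately show "norm (\<kappa> n - 0) < r" by simp
    qed
  qed
  moreover have "err n a \<le> \<kappa> n" if "a \<le> n" for n a
    unfolding \<kappa>_def using that by (intro Max_ge) auto
  ultimately show ?thesis unfolding err_def by blast
qed

section \<open>Contraction in the \<open>\<ell>\<^sub>1\<close> distance\<close>

text \<open>
  A smooth replacement for \<open>\<bar>y\<bar>\<close> and its derivative. The absolute value itself cannot be used: its
  Taylor error at the kink is of order \<open>1/n\<close> for a jump of size \<open>1/n\<close>, and jumps occur at rate \<open>O(n)\<close>.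
\<close>

definition smooth_abs :: "real \<Rightarrow> real \<Rightarrow> real" where
  "smooth_abs \<epsilon> y = sqrt (y\<^sup>2 + \<epsilon>\<^sup>2)"

definition smooth_sgn :: "real \<Rightarrow> real \<Rightarrow> real" where
  "smooth_sgn \<epsilon> y = y / smooth_abs \<epsilon> y"

context
  fixes \<epsilon> :: real
  assumes \<epsilon>: "0 < \<epsilon>"
begin

lemma smooth_abs_bounds: "\<epsilon> \<le> smooth_abs \<epsilon> y" "\<bar>y\<bar> \<le> smooth_abs \<epsilon> y" "smooth_abs \<epsilon> y \<le> \<bar>y\<bar> + \<epsilon>"
proof -
  show "\<epsilon> \<le> smooth_abs \<epsilon> y" unfolding smooth_abs_def by (rule real_le_rsqrt) simp
  show "\<bar>y\<bar> \<le> smooth_abs \<epsilon> y" unfolding smooth_abs_def by (rule real_le_rsqrt) simp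
  show "smooth_abs \<epsilon> y \<le> \<bar>y\<bar> + \<epsilon>" unfolding smooth_abs_def using \<epsilon>
    by (intro real_le_lsqrt) (auto simp: power2_sum)
qed

lemma smooth_abs_pos: "0 < smooth_abs \<epsilon> y"
  using smooth_abs_bounds(1)[of y] \<epsilon> by linarith

lemma smooth_abs_quadratic:
  "smooth_abs \<epsilon> (y + d) \<le> smooth_abs \<epsilon> y + smooth_sgn \<epsilon> y * d + 1 / (2 * \<epsilon>) * d\<^sup>2"
proof -
  define A where "A = smooth_abs \<epsilon> y"
  have A: "0 < A" "\<epsilon> \<le> A" using smooth_abs_pos smooth_abs_bounds(1) by (simp_all add: A_def)
  have A2: "A\<^sup>2 = y\<^sup>2 + \<epsilon>\<^sup>2" by (simp add: A_def smooth_abs_def)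
  have sq: "(y + d)\<^sup>2 + \<epsilon>\<^sup>2 = A\<^sup>2 + (2 * y * d + d\<^sup>2)" unfolding A2 by (simp add: power2_sum)
  let ?r = "(2 * y * d + d\<^sup>2) / (2 * A)"
  have "A + ?r = (A\<^sup>2 + ((y + d)\<^sup>2 + \<epsilon>\<^sup>2)) / (2 * A)"
    unfolding sq using A by (simp add: field_simps power2_eq_square)
  then have nn: "0 \<le> A + ?r" using A by simp
  have "(A + ?r)\<^sup>2 = A\<^sup>2 + (2 * y * d + d\<^sup>2) + ?r\<^sup>2"
    using A by (simp add: power2_sum)
  then have "(y + d)\<^sup>2 + \<epsilon>\<^sup>2 \<le> (A + ?r)\<^sup>2" unfolding sq by simp
  then have "smooth_abs \<epsilon> (y + d) \<le> A + ?r" unfolding smooth_abs_def by (intro real_le_lsqrt nn)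
  also have "\<dots> = A + y / A * d + 1 / (2 * A) * d\<^sup>2" using A by (simp add: field_simps)
  also have "\<dots> \<le> A + y / A * d + 1 / (2 * \<epsilon>) * d\<^sup>2"
    using A \<epsilon> by (intro add_left_mono mult_right_mono) (auto intro: divide_left_mono)
  finally show ?thesis by (simp add: A_def smooth_sgn_def)
qed

lemma smooth_sgn_le_1: "\<bar>smooth_sgn \<epsilon> y\<bar> \<le> 1"
  using smooth_abs_bounds(2)[of y] smooth_abs_pos[of y] by (simp add: smooth_sgn_def divide_le_eq)

lemma smooth_sgn_defect: "\<bar>y\<bar> * (1 - \<bar>smooth_sgn \<epsilon> y\<bar>) \<le> \<epsilon>"
proof -
  let ?A = "smooth_abs \<epsilon> y"
  have "\<bar>y\<bar> * (1 - \<bar>smooth_sgn \<epsilon> y\<bar>) = \<bar>smooth_sgn \<epsilon> y\<bar> * (?A - \<bar>y\<bar>)"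
    using smooth_abs_pos[of y] by (simp add: smooth_sgn_def field_simps)
  also have "\<dots> \<le> 1 * \<epsilon>"
    using smooth_sgn_le_1[of y] smooth_abs_bounds(2,3)[of y] \<epsilon> by (intro mult_mono) auto
  finally show ?thesis by simp
qed

text \<open>
  The error of treating \<open>smooth_sgn \<epsilon> y\<close> as the sign of \<open>y\<close> when it multiplies a \<open>z\<close> of the same
  sign; it is small because \<open>smooth_sgn\<close> is far from \<open>\<plusminus>1\<close> only where \<open>y\<close>, and hence \<open>z\<close>, is small.
\<close>

lemma smooth_sgn_times:
  assumes "0 \<le> y * z" "\<bar>z\<bar> \<le> L * \<bar>y\<bar>" and L: "0 \<le> L"
  shows "\<bar>z\<bar> - smooth_sgn \<epsilon> y * z \<le> L * \<epsilon>"
proof -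
  have "smooth_sgn \<epsilon> y * z = \<bar>smooth_sgn \<epsilon> y\<bar> * \<bar>z\<bar>"
    using assms(1) smooth_abs_pos[of y] by (simp add: smooth_sgn_def abs_mult[symmetric])
  then have "\<bar>z\<bar> - smooth_sgn \<epsilon> y * z = \<bar>z\<bar> * (1 - \<bar>smooth_sgn \<epsilon> y\<bar>)" by (simp add: algebra_simps)
  also have "\<dots> \<le> L * \<bar>y\<bar> * (1 - \<bar>smooth_sgn \<epsilon> y\<bar>)"
    using assms(2) smooth_sgn_le_1[of y] by (intro mult_right_mono) auto
  also have "\<dots> \<le> L * \<epsilon>" using mult_left_mono[OF smooth_sgn_defect L] by (simp add: mult.assoc)
  finally show ?thesis .
qed

lemma smooth_sgn_lipschitz: "\<bar>smooth_sgn \<epsilon> y - smooth_sgn \<epsilon> z\<bar> \<le> 2 / \<epsilon> * \<bar>y - z\<bar>"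
proof -
  define A B where "A = smooth_abs \<epsilon> y" and "B = smooth_abs \<epsilon> z"
  have A: "0 < A" "\<epsilon> \<le> A" and B: "0 < B" "\<bar>z\<bar> \<le> B"
    using smooth_abs_pos smooth_abs_bounds by (simp_all add: A_def B_def)
  have "\<bar>A - B\<bar> * (A + B) = \<bar>A\<^sup>2 - B\<^sup>2\<bar>"
    using A B by (simp add: power2_eq_square abs_mult[symmetric] square_diff_square_factored abs_mult mult.commute)
  also have "\<dots> = \<bar>y - z\<bar> * \<bar>y + z\<bar>"
    by (simp add: A_def B_def smooth_abs_def power2_eq_square square_diff_square_factored abs_mult mult.commute)
  also have "\<dots> \<le> \<bar>y - z\<bar> * (A + B)"
    using smooth_abs_bounds(2)[of y] B by (intro mult_left_mono) (auto simp: A_def)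
  finally have AB: "\<bar>A - B\<bar> \<le> \<bar>y - z\<bar>" using A B by (simp add: mult_le_cancel_right)
  have "y / A - z / B = (y - z) / A + z / B * ((B - A) / A)"
    using A B by (simp add: field_simps)
  also have "\<bar>\<dots>\<bar> \<le> \<bar>y - z\<bar> / A + 1 * (\<bar>y - z\<bar> / A)"
    by (intro order_trans[OF abs_triangle_ineq], unfold abs_mult abs_divide, intro add_mono mult_mono)
       (use A B AB in \<open>auto simp: divide_right_mono divide_le_eq\<close>)
  also have "\<dots> \<le> \<bar>y - z\<bar> / \<epsilon> + 1 * (\<bar>y - z\<bar> / \<epsilon>)"
    using A \<epsilon> by (intro add_mono mult_left_mono divide_left_mono) auto
  finally show ?thesis by (simp add: smooth_sgn_def A_def B_def)
qed

end

text \<open>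
  One term of the drift of the smoothed \<open>\<ell>\<^sub>1\<close> distance, in the notation \<open>q, q'\<close> for the occupancies at
  levels \<open>i, i + 1\<close>, \<open>\<alpha>, \<alpha>'\<close> for the fixed point at these levels, \<open>B', B\<close> and \<open>\<beta>', \<beta>\<close> for the images
  of the occupancies and of the fixed point under \<open>b\<close> at levels \<open>i - 1, i\<close>, \<open>N', N\<close> for the true
  neighbourhood occupancies and \<open>m', m\<close> for their graph averages. The bound telescopes over \<open>i\<close>, up to
  small constants and the fluctuation \<open>N - m\<close>, which is only small in mean.
\<close>

lemma entropy_term_le:
  fixes g :: real
  assumes g: "\<bar>g\<bar> \<le> 1" and l: "0 \<le> l" and r: "0 \<le> r"
    and sgn: "\<bar>B - \<beta>\<bar> - g * (B - \<beta>) \<le> c" "\<bar>q - \<alpha>\<bar> - g * (q - \<alpha>) \<le> c'"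
    and fixp: "l * (\<beta>' - \<beta>) = \<alpha> - \<alpha>'"
    and B: "\<bar>B' - B\<bar> \<le> 1" and m: "\<bar>m' - B'\<bar> \<le> \<kappa>" "\<bar>m - B\<bar> \<le> \<kappa>"
  shows "g * (r * (N' - N) - (q - q'))
    \<le> (l * \<bar>B' - \<beta>'\<bar> - l * \<bar>B - \<beta>\<bar>) - (\<bar>q - \<alpha>\<bar> - \<bar>q' - \<alpha>'\<bar>)
      + (l * c + c' + \<bar>r - l\<bar> + 2 * r * \<kappa>) + r * (g * (N' - m') - g * (N - m))"
proof -
  have le: "g * x \<le> \<bar>x\<bar>" for x
    using mult_right_mono[OF g, of "\<bar>x\<bar>"] abs_ge_self[of "g * x"] by (simp add: abs_mult)
  have "g * (r * (N' - N) - (q - q'))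
      = l * (g * (B' - \<beta>')) - l * (g * (B - \<beta>)) - g * (q - \<alpha>) + g * (q' - \<alpha>')
        + g * ((r - l) * (B' - B)) + r * (g * ((m' - B') - (m - B))) + r * (g * (N' - m') - g * (N - m))
        + g * (l * (\<beta>' - \<beta>) - (\<alpha> - \<alpha>'))"
    by (simp add: algebra_simps)
  also have "g * (l * (\<beta>' - \<beta>) - (\<alpha> - \<alpha>')) = 0" using fixp by simp
  also have "l * (g * (B' - \<beta>')) \<le> l * \<bar>B' - \<beta>'\<bar>" by (intro mult_left_mono le l)
  moreover have "- (l * (g * (B - \<beta>))) \<le> l * c - l * \<bar>B - \<beta>\<bar>"
    using mult_left_mono[OF sgn(1) l] by (simp add: algebra_simps)
  moreover have "g * (q' - \<alpha>') \<le> \<bar>q' - \<alpha>'\<bar>" by (rule le)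
  moreover have "g * ((r - l) * (B' - B)) \<le> \<bar>r - l\<bar>"
    using le[of "(r - l) * (B' - B)"] mult_left_mono[OF B, of "\<bar>r - l\<bar>"] by (simp add: abs_mult)
  moreover have "r * (g * ((m' - B') - (m - B))) \<le> r * (2 * \<kappa>)"
    using le[of "(m' - B') - (m - B)"] m by (intro mult_left_mono r) linarith
  ultimately show ?thesis using sgn(2) by linarith
qed

lemma sum_differences:
  fixes f :: "nat \<Rightarrow> real"
  assumes "k \<le> m"
  shows "(\<Sum>i\<in>{Suc k..Suc m}. f (i - 1) - f i) = f k - f (Suc m)"
    and "(\<Sum>i\<in>{Suc k..Suc m}. f i - f (i + 1)) = f (Suc k) - f (Suc (Suc m))"
  using assms by (induction m rule: dec_induct) auto

context load_balancing
begin

lemma dm_nonneg: "0 \<le> dm"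
proof -
  obtain E where "E \<in> set_pmf G" using set_pmf_not_empty[of G] by blast
  from indeg[OF this, of 1] show ?thesis using n by simp
qed

text \<open>
  The drift of the smoothed \<open>\<ell>\<^sub>1\<close> distance over the levels from \<open>k + 1\<close> to \<open>m + 1\<close> telescopes to an
  inflow at level \<open>k\<close>, the term that is to be bounded at level \<open>k + 1\<close>, and a boundary term at level
  \<open>m + 2\<close>. The remainder collects the errors from smoothing, from \<open>rho \<noteq> l\<close>, from the approximation of
  averaged rates by \<open>b\<close>, from the fluctuations of the graph and from the jump size \<open>1/n\<close>.
\<close>

lemma contraction_step:
  fixes a :: "nat \<Rightarrow> real" and b :: "real \<Rightarrow> real"
  assumes a: "\<And>i. 0 \<le> a i" "\<And>i. a i \<le> 1" and fixp: "\<And>i. a (Suc i) = l * b (a i)" and l: "0 \<le> l"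
    and b: "\<And>x. 0 \<le> x \<Longrightarrow> x \<le> 1 \<Longrightarrow> 0 \<le> b x \<and> b x \<le> 1"
    and mono: "\<And>x y. 0 \<le> x \<Longrightarrow> x \<le> y \<Longrightarrow> y \<le> 1 \<Longrightarrow> b x \<le> b y"
    and lip: "\<And>x y. 0 \<le> x \<Longrightarrow> x \<le> 1 \<Longrightarrow> 0 \<le> y \<Longrightarrow> y \<le> 1 \<Longrightarrow> \<bar>b x - b y\<bar> \<le> L * \<bar>x - y\<bar>"
    and mean: "\<And>x i. \<bar>nbhd_occ_mean n G x i - b (occ n x i)\<bar> \<le> \<kappa>"
    and \<epsilon>: "0 < \<epsilon>" and k: "k \<le> m"
  shows "(\<integral>s. \<bar>occ n (fst s) (Suc k) - a (Suc k)\<bar> \<partial>\<pi>)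
    \<le> l * L * (\<integral>s. \<bar>occ n (fst s) k - a k\<bar> \<partial>\<pi>)
      + (\<integral>s. \<bar>occ n (fst s) (Suc (Suc m)) - a (Suc (Suc m))\<bar> \<partial>\<pi>)
      + (real (Suc m) * (l * (L * \<epsilon>) + \<epsilon> + \<bar>rho - l\<bar> + 2 * rho * \<kappa>
          + 2 * rho * ((rho + 1) * (2 / \<epsilon> + 2) * ((dm + 1) / mu)))
        + (rho + 1) * (1 / (2 * \<epsilon>)) / real n)"
proof -
  define I where "I = {Suc k..Suc m}"
  define q where "q s i = occ n (fst s) i" for s :: state and i
  define N where "N s i = nbhd_occ n (fst s) (snd s) i" for s :: state and i
  define M where "M s i = nbhd_occ_mean n G (fst s) i" for s :: state and i
  define g where "g s i = smooth_sgn \<epsilon> (q s i - a i)" for s :: state and i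
  define U where "U s i = rho * (g s i * (N s (i - 1) - M s (i - 1)) - g s i * (N s i - M s i))" for s i
  define \<eta> where "\<eta> = (rho + 1) * (2 / \<epsilon> + 2) * ((dm + 1) / mu)"
  define c where "c = l * (L * \<epsilon>) + \<epsilon> + \<bar>rho - l\<bar> + 2 * rho * \<kappa>"
  let ?f = "\<lambda>s :: state. \<Sum>i\<in>I. smooth_abs \<epsilon> (occ n (fst s) i - a i)"
  have q: "0 \<le> q s i" "q s i \<le> 1" for s i by (simp_all add: q_def occ_nonneg occ_le_1)
  have e1: "\<bar>q s i - a i\<bar> \<le> 1" for s i using q[of s i] a[of i] by linarith
  have cardI: "real (card I) \<le> real (Suc m)" by (simp add: I_def)
  have "\<bar>b 1 - b 0\<bar> \<le> L" using lip[of 1 0] by simp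
  then have L: "0 \<le> L" by linarith
  have "0 \<le> \<kappa>" using mean[of undefined 0] by linarith
  have "0 \<le> c" unfolding c_def
    by (intro add_nonneg_nonneg mult_nonneg_nonneg l L \<open>0 \<le> \<kappa>\<close>)
       (use \<epsilon> less_imp_le[OF rho_pos] in auto)

  have term_le: "g s i * (rho * (N s (i - 1) - N s i) - (q s i - q s (i + 1)))
      \<le> (l * \<bar>b (q s (i - 1)) - b (a (i - 1))\<bar> - l * \<bar>b (q s i) - b (a i)\<bar>)
        - (\<bar>q s i - a i\<bar> - \<bar>q s (i + 1) - a (i + 1)\<bar>) + c + U s i" if i: "i \<in> I" for s i
    unfolding U_def c_def
  proof (rule entropy_term_le)
    show "\<bar>g s i\<bar> \<le> 1" unfolding g_def by (rule smooth_sgn_le_1[OF \<epsilon>])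
    have "0 \<le> (q s i - a i) * (b (q s i) - b (a i))"
      using mono[of "q s i" "a i"] mono[of "a i" "q s i"] q[of s i] a[of i]
      by (cases "q s i \<le> a i") (auto intro: mult_nonneg_nonneg mult_nonpos_nonpos)
    then show "\<bar>b (q s i) - b (a i)\<bar> - g s i * (b (q s i) - b (a i)) \<le> L * \<epsilon>"
      unfolding g_def by (intro smooth_sgn_times[OF \<epsilon>] lip q a L)
    show "\<bar>q s i - a i\<bar> - g s i * (q s i - a i) \<le> \<epsilon>"
      using smooth_sgn_times[OF \<epsilon>, of "q s i - a i" "q s i - a i" 1] by (simp add: g_def)
    show "l * (b (a (i - 1)) - b (a i)) = a i - a (i + 1)"
      using fixp[of "i - 1"] fixp[of i] i by (simp add: I_def right_diff_distrib)
    show "\<bar>b (q s (i - 1)) - b (q s i)\<bar> \<le> 1" 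
      using b[of "q s (i - 1)"] b[of "q s i"] q by (simp add: abs_le_iff)
    show "\<bar>M s (i - 1) - b (q s (i - 1))\<bar> \<le> \<kappa>" "\<bar>M s i - b (q s i)\<bar> \<le> \<kappa>"
      unfolding M_def q_def by (rule mean)+
  qed (use l rho_pos in auto)

  have drift_le: "drift n lam mu G D ?f s
      \<le> l * L * \<bar>q s k - a k\<bar> - \<bar>q s (Suc k) - a (Suc k)\<bar> + \<bar>q s (Suc (Suc m)) - a (Suc (Suc m))\<bar>
        + ((\<Sum>i\<in>I. U s i) + (real (Suc m) * c + (rho + 1) * (1 / (2 * \<epsilon>)) / real n))"
    if s: "s \<in> set_pmf \<pi>" for s
  proof -
    have E: "snd s \<in> set_pmf G" using s stationary_graph[of "fst s" "snd s"] by simp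
    have quad: "smooth_abs \<epsilon> (y + d - a i) \<le> smooth_abs \<epsilon> (y - a i) + smooth_sgn \<epsilon> (y - a i) * d
        + 1 / (2 * \<epsilon>) * d\<^sup>2" for i y d
      using smooth_abs_quadratic[OF \<epsilon>, of "y - a i" d] by (simp add: algebra_simps)
    have "drift n lam mu G D ?f s
        \<le> (\<Sum>i\<in>I. g s i * (rho * (N s (i - 1) - N s i) - (q s i - q s (i + 1))))
          + (rho + 1) * (1 / (2 * \<epsilon>)) / real n"
      using drift_separable_le[OF E, of I "1 / (2 * \<epsilon>)" "\<lambda>i y. smooth_abs \<epsilon> (y - a i)"
          "\<lambda>i y. smooth_sgn \<epsilon> (y - a i)" "fst s", OF _ _ _ quad] \<epsilon>
      by (simp add: I_def g_def N_def q_def)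
    also have "(\<Sum>i\<in>I. g s i * (rho * (N s (i - 1) - N s i) - (q s i - q s (i + 1))))
        \<le> (\<Sum>i\<in>I. (l * \<bar>b (q s (i - 1)) - b (a (i - 1))\<bar> - l * \<bar>b (q s i) - b (a i)\<bar>)
            - (\<bar>q s i - a i\<bar> - \<bar>q s (i + 1) - a (i + 1)\<bar>) + c + U s i)"
      by (intro sum_mono term_le)
    also have "\<dots> = (l * \<bar>b (q s k) - b (a k)\<bar> - l * \<bar>b (q s (Suc m)) - b (a (Suc m))\<bar>)
        - (\<bar>q s (Suc k) - a (Suc k)\<bar> - \<bar>q s (Suc (Suc m)) - a (Suc (Suc m))\<bar>)
        + real (card I) * c + (\<Sum>i\<in>I. U s i)"
      unfolding sum.distrib sum_subtractf[of "\<lambda>i. l * \<bar>b (q s (i - 1)) - b (a (i - 1))\<bar> - l * \<bar>b (q s i) - b (a i)\<bar>"]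
      using sum_differences(1)[OF k, of "\<lambda>i. l * \<bar>b (q s i) - b (a i)\<bar>"]
        sum_differences(2)[OF k, of "\<lambda>i. \<bar>q s i - a i\<bar>"]
      by (simp only: I_def[symmetric] sum_constant)
    also have "\<dots> \<le> l * L * \<bar>q s k - a k\<bar> - (\<bar>q s (Suc k) - a (Suc k)\<bar> - \<bar>q s (Suc (Suc m)) - a (Suc (Suc m))\<bar>)
        + real (Suc m) * c + (\<Sum>i\<in>I. U s i)"
    proof -
      have "l * \<bar>b (q s k) - b (a k)\<bar> \<le> l * L * \<bar>q s k - a k\<bar>"
        using mult_left_mono[OF lip[OF q a, of s k k] l] by (simp add: mult.assoc)
      moreover have "0 \<le> l * \<bar>b (q s (Suc m)) - b (a (Suc m))\<bar>" using l by simp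
      moreover have "real (card I) * c \<le> real (Suc m) * c"
        by (intro mult_right_mono cardI \<open>0 \<le> c\<close>)
      ultimately show ?thesis by linarith
    qed
    finally show ?thesis by linarith
  qed

  have bd: "\<bar>?f s\<bar> \<le> (\<Sum>i\<in>I. 1 + \<epsilon>)" for s
  proof (rule order_trans[OF sum_abs], rule sum_mono)
    fix i
    show "\<bar>smooth_abs \<epsilon> (occ n (fst s) i - a i)\<bar> \<le> 1 + \<epsilon>"
      using smooth_abs_bounds(3)[OF \<epsilon>, of "q s i - a i"] smooth_abs_pos[OF \<epsilon>, of "q s i - a i"] e1[of s i]
      by (simp add: q_def)
  qed

  have avg1: "\<bar>g s i * (N s j - M s j)\<bar> \<le> 1" for s i j
  proof -
    have "\<bar>N s j - M s j\<bar> \<le> 1"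
      using nbhd_occ_nonneg[of n "fst s" "snd s" j] nbhd_occ_bounded[of n "fst s" "snd s" j]
        nbhd_occ_mean_nonneg[of n G "fst s" j] nbhd_occ_mean_le_1[of n G "fst s" j]
      unfolding N_def M_def by linarith
    then show ?thesis unfolding g_def abs_mult using smooth_sgn_le_1[OF \<epsilon>] by (intro mult_le_one) auto
  qed
  then have int_avg: "integrable \<pi> (\<lambda>s. g s i * (N s j - M s j))" for i j
    by (rule integrable_pmf_bounded)
  have avg: "\<bar>\<integral>s. g s i * (N s j - M s j) \<partial>\<pi>\<bar> \<le> \<eta>" if i: "i \<in> I" for i j
  proof -
    have i1: "1 \<le> i" using i by (simp add: I_def)
    have lipF: "\<bar>smooth_sgn \<epsilon> (y - a i) - smooth_sgn \<epsilon> (z - a i)\<bar> \<le> 2 / \<epsilon> / real n"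
      if "\<bar>y - z\<bar> \<le> 1 / real n" for y z
      using smooth_sgn_lipschitz[OF \<epsilon>, of "y - a i" "z - a i"]
        mult_left_mono[OF that, of "2 / \<epsilon>"] \<epsilon> by simp
    have up: "\<bar>occ n (x(v := x v + 1)) i - occ n x i\<bar> \<le> 1 / real n"
      and down: "\<bar>occ n (x(v := x v - 1)) i - occ n x i\<bar> \<le> 1 / real n" if "v \<in> {1..n}" for x v
      unfolding occ_arrival[OF that i1] occ_departure[OF that i1] by simp_all
    have "\<bar>\<integral>s. smooth_sgn \<epsilon> (occ n (fst s) i - a i)
          * (nbhd_occ n (fst s) (snd s) j - nbhd_occ_mean n G (fst s) j) \<partial>\<pi>\<bar>
        \<le> (rho + 1) * (2 / \<epsilon> + 2 * (dm + 1)) / mu"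
      by (intro graph_averaging smooth_sgn_le_1[OF \<epsilon>] lipF up down)
    also have "\<dots> \<le> \<eta>"
    proof -
      have "2 / \<epsilon> + 2 * (dm + 1) \<le> (2 / \<epsilon> + 2) * (dm + 1)"
        using dm_nonneg \<epsilon> by (simp add: algebra_simps divide_right_mono)
      then have "(rho + 1) * (2 / \<epsilon> + 2 * (dm + 1)) / mu \<le> (rho + 1) * ((2 / \<epsilon> + 2) * (dm + 1)) / mu"
        using rho_pos mu by (intro divide_right_mono mult_left_mono) auto
      then show ?thesis by (simp add: \<eta>_def mult.assoc)
    qed
    finally show ?thesis by (simp add: g_def q_def N_def M_def)
  qed
  have intU: "integrable \<pi> (\<lambda>s. \<Sum>i\<in>I. U s i)" unfolding U_def using int_avg by simp
  have U_le: "(\<integral>s. (\<Sum>i\<in>I. U s i) \<partial>\<pi>) \<le> real (Suc m) * (2 * rho * \<eta>)"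
  proof -
    have "(\<integral>s. (\<Sum>i\<in>I. U s i) \<partial>\<pi>) = (\<Sum>i\<in>I. \<integral>s. U s i \<partial>\<pi>)"
      by (rule Bochner_Integration.integral_sum) (use int_avg in \<open>simp add: U_def\<close>)
    also have "\<dots> \<le> (\<Sum>i\<in>I. 2 * rho * \<eta>)"
    proof (rule sum_mono)
      fix i assume i: "i \<in> I"
      have "(\<integral>s. U s i \<partial>\<pi>) = rho * ((\<integral>s. g s i * (N s (i - 1) - M s (i - 1)) \<partial>\<pi>)
          - (\<integral>s. g s i * (N s i - M s i) \<partial>\<pi>))"
        unfolding U_def using int_avg by simp
      also have "\<dots> \<le> rho * (2 * \<eta>)"
        using avg[OF i, of "i - 1"] avg[OF i, of i] rho_pos by (intro mult_left_mono) linarith+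
      finally show "(\<integral>s. U s i \<partial>\<pi>) \<le> 2 * rho * \<eta>" by (simp add: mult.left_commute mult.assoc)
    qed
    also have "\<dots> = real (card I) * (2 * rho * \<eta>)" by simp
    also have "\<dots> \<le> real (Suc m) * (2 * rho * \<eta>)"
    proof (intro mult_right_mono cardI mult_nonneg_nonneg)
      have "Suc k \<in> I" using k by (simp add: I_def)
      from order_trans[OF abs_ge_zero avg[OF this, of 0]] show "0 \<le> \<eta>" .
    qed (use less_imp_le[OF rho_pos] in auto)
    finally show ?thesis .
  qed
  have inte: "integrable \<pi> (\<lambda>s. \<bar>q s i - a i\<bar>)" for i
    by (rule integrable_pmf_bounded[of _ _ 1]) (simp add: e1)
  have "0 = (\<integral>s. drift n lam mu G D ?f s \<partial>\<pi>)"
    using stationary_drift(1)[of ?f, OF bd] by simp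
  also have "\<dots> \<le> (\<integral>s. l * L * \<bar>q s k - a k\<bar> - \<bar>q s (Suc k) - a (Suc k)\<bar> + \<bar>q s (Suc (Suc m)) - a (Suc (Suc m))\<bar>
        + ((\<Sum>i\<in>I. U s i) + (real (Suc m) * c + (rho + 1) * (1 / (2 * \<epsilon>)) / real n)) \<partial>\<pi>)"
    using stationary_drift(2)[of ?f, OF bd] inte intU
    by (intro integral_pmf_mono drift_le) simp_all
  also have "\<dots> = l * L * (\<integral>s. \<bar>q s k - a k\<bar> \<partial>\<pi>) - (\<integral>s. \<bar>q s (Suc k) - a (Suc k)\<bar> \<partial>\<pi>)
        + (\<integral>s. \<bar>q s (Suc (Suc m)) - a (Suc (Suc m))\<bar> \<partial>\<pi>)
        + ((\<integral>s. (\<Sum>i\<in>I. U s i) \<partial>\<pi>) + (real (Suc m) * c + (rho + 1) * (1 / (2 * \<epsilon>)) / real n))"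
    using inte intU by (simp del: of_nat_Suc)
  finally show ?thesis using U_le unfolding q_def c_def \<eta>_def distrib_left by linarith
qed

end

section \<open>The limiting recursion\<close>

context
  fixes p :: "nat \<Rightarrow> real"
  assumes p: "\<And>d. 0 \<le> p d" and sums: "p sums 1" and mean: "summable (\<lambda>d. real d * p d)"
begin

text \<open>
  The product \<open>x * phi p x\<close> is handled as a single power series, the generating function of the
  size of a closed neighbourhood.
\<close>

lemma times_phi_eq:
  assumes "0 \<le> x" "x \<le> 1"
  shows "(\<lambda>d. x ^ Suc d * p d) sums (x * phi p x)"
proof -
  have "summable (\<lambda>d. x ^ d * p d)"
    using assms by (intro series_truncation(1)[OF _ p sums]) (auto intro: power_le_one)
  from sums_mult[OF summable_sums[OF this], of x] show ?thesis
    by (simp add: phi_def mult.assoc)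
qed

lemma times_phi_bounds:
  assumes "0 \<le> x" "x \<le> 1"
  shows "0 \<le> x * phi p x" "x * phi p x \<le> x" "x * phi p x \<le> 1"
proof -
  show "0 \<le> x * phi p x"
    using sums_le[OF _ sums_zero times_phi_eq[OF assms]] assms p by simp
  show le: "x * phi p x \<le> x"
  proof (rule sums_le[OF _ times_phi_eq[OF assms]])
    show "(\<lambda>d. x * p d) sums x" using sums_mult[OF sums, of x] by simp
    show "x ^ Suc d * p d \<le> x * p d" for d
      using assms power_le_one[OF assms, of d] p[of d] by (intro mult_right_mono) (auto intro: mult_left_le)
  qed
  then show "x * phi p x \<le> 1" using assms by simp
qed

lemma times_phi_mono:
  assumes "0 \<le> x" "x \<le> y" "y \<le> 1"
  shows "x * phi p x \<le> y * phi p y"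
  using assms p
  by (intro sums_le[OF _ times_phi_eq times_phi_eq] mult_right_mono power_mono) auto

lemma times_phi_lipschitz:
  assumes x: "0 \<le> x" "x \<le> 1" and y: "0 \<le> y" "y \<le> 1"
  shows "\<bar>x * phi p x - y * phi p y\<bar> \<le> (1 + (\<Sum>d. real d * p d)) * \<bar>x - y\<bar>"
proof -
  have d: "(\<lambda>d. x ^ Suc d * p d - y ^ Suc d * p d) sums (x * phi p x - y * phi p y)"
    by (intro sums_diff times_phi_eq x y)
  have "(\<lambda>d. p d + real d * p d) sums (1 + (\<Sum>d. real d * p d))"
    by (intro sums_add sums summable_sums mean)
  from sums_mult2[OF this, of "\<bar>x - y\<bar>"]
  have M: "(\<lambda>d. real (Suc d) * \<bar>x - y\<bar> * p d) sums ((1 + (\<Sum>d. real d * p d)) * \<bar>x - y\<bar>)"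
    by (simp add: algebra_simps)
  have le: "\<bar>x ^ Suc d * p d - y ^ Suc d * p d\<bar> \<le> real (Suc d) * \<bar>x - y\<bar> * p d" for d
  proof -
    have "\<bar>x ^ Suc d - y ^ Suc d\<bar> \<le> real (Suc d) * \<bar>x - y\<bar>"
      using norm_power_diff[of x y "Suc d"] x y by simp
    from mult_right_mono[OF this p[of d]] show ?thesis
      using p[of d] by (simp only: left_diff_distrib[symmetric] abs_mult abs_of_nonneg)
  qed
  then have "x ^ Suc d * p d - y ^ Suc d * p d \<le> real (Suc d) * \<bar>x - y\<bar> * p d"
    "- (x ^ Suc d * p d - y ^ Suc d * p d) \<le> real (Suc d) * \<bar>x - y\<bar> * p d" for d
    by (meson abs_le_D1 abs_le_D2)+
  then show ?thesis
    using sums_le[OF _ d M] sums_le[OF _ sums_minus[OF d] M] by (intro abs_leI) blast+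
qed

text \<open>
  The first step of the recursion is not special, because \<open>phi p 1 = 1\<close>.
\<close>

lemma qstar_Suc: "qstar l p (Suc i) = l * (qstar l p i * phi p (qstar l p i))"
proof (cases i)
  case 0
  have "1 * phi p 1 = 1" using sums_unique2[OF times_phi_eq[of 1]] sums by simp
  then show ?thesis using 0 by simp
qed simp

lemma qstar_bounds:
  assumes "0 \<le> l" "l \<le> 1"
  shows "0 \<le> qstar l p i" "qstar l p i \<le> l ^ i" "qstar l p i \<le> 1"
proof -
  have "0 \<le> qstar l p i \<and> qstar l p i \<le> l ^ i"
  proof (induction i)
    case (Suc i)
    have "l ^ i \<le> 1" using assms by (rule power_le_one)
    then have q: "0 \<le> qstar l p i" "qstar l p i \<le> 1" using Suc by auto
    have "qstar l p i * phi p (qstar l p i) \<le> l ^ i" using times_phi_bounds(2)[OF q] Suc by linarith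
    then show ?case unfolding qstar_Suc power_Suc using times_phi_bounds(1)[OF q] assms
      by (auto intro: mult_left_mono)
  qed simp
  then show "0 \<le> qstar l p i" "qstar l p i \<le> l ^ i" "qstar l p i \<le> 1"
    using power_le_one[OF assms, of i] by auto
qed

end

section \<open>Weak convergence of the occupancy states\<close>

text \<open>
  Convergence in mean to a constant implies weak convergence: for \<open>y\<close> away from the limit point \<open>q\<close>, a
  bounded function deviates from its value at \<open>q\<close> by at most a multiple of \<open>norm (y - q)\<close>.
\<close>

lemma weakly_converges_return:
  fixes X :: "nat \<Rightarrow> 's \<Rightarrow> 'a :: real_normed_vector" and \<mu> :: "nat \<Rightarrow> 's pmf"
  assumes int: "eventually (\<lambda>n. integrable (\<mu> n) (\<lambda>s. norm (X n s - q))) sequentially"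
    and lim: "(\<lambda>n. \<integral>s. norm (X n s - q) \<partial>\<mu> n) \<longlonglongrightarrow> 0"
  shows "weakly_converges (\<lambda>n. distr (measure_pmf (\<mu> n)) borel (X n)) (return borel q)"
  unfolding weakly_converges_def
proof (intro allI impI)
  fix f :: "'a \<Rightarrow> real"
  assume cont: "continuous_on UNIV f" and "bounded (range f)"
  then obtain C where C: "\<And>y. \<bar>f y\<bar> \<le> C" by (auto simp: bounded_iff)
  have meas: "f \<in> borel_measurable borel" using cont by (rule borel_measurable_continuous_onI)
  have "(\<lambda>n. \<integral>s. f (X n s) \<partial>\<mu> n) \<longlonglongrightarrow> f q"
  proof (rule LIMSEQ_I)
    fix r :: real assume r: "0 < r"
    have "continuous (at q) f" using cont by (simp add: continuous_on_eq_continuous_at)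
    then obtain \<delta> where \<delta>: "0 < \<delta>" "\<And>y. dist y q < \<delta> \<Longrightarrow> dist (f y) (f q) < r / 2"
      unfolding continuous_at_eps_delta using r by (metis half_gt_zero)
    have C0: "0 \<le> C" using C[of q] by linarith
    have bd: "\<bar>f y - f q\<bar> \<le> r / 2 + 2 * C / \<delta> * norm (y - q)" for y
    proof (cases "dist y q < \<delta>")
      case True
      have "0 \<le> 2 * C / \<delta> * norm (y - q)" using C0 \<delta>(1) by simp
      with \<delta>(2)[OF True] show ?thesis by (simp add: dist_real_def)
    next
      case False
      have "2 * C / \<delta> * \<delta> \<le> 2 * C / \<delta> * norm (y - q)"
        using False C0 \<delta>(1) by (intro mult_left_mono) (auto simp: dist_norm)
      then have "2 * C \<le> 2 * C / \<delta> * norm (y - q)" using \<delta>(1) by simp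
      then show ?thesis using C[of y] C[of q] r by linarith
    qed
    have "(\<lambda>n. r / 2 + 2 * C / \<delta> * (\<integral>s. norm (X n s - q) \<partial>\<mu> n)) \<longlonglongrightarrow> r / 2 + 2 * C / \<delta> * 0"
      by (intro tendsto_intros lim)
    then have "eventually (\<lambda>n. r / 2 + 2 * C / \<delta> * (\<integral>s. norm (X n s - q) \<partial>\<mu> n) < r) sequentially"
      by (rule order_tendstoD) (use r in simp)
    with int have "eventually (\<lambda>n. norm ((\<integral>s. f (X n s) \<partial>\<mu> n) - f q) < r) sequentially"
    proof eventually_elim
      case (elim n)
      have intf: "integrable (\<mu> n) (\<lambda>s. f (X n s))" using C by (rule integrable_pmf_bounded)
      have "\<bar>(\<integral>s. f (X n s) \<partial>\<mu> n) - f q\<bar> = \<bar>\<integral>s. f (X n s) - f q \<partial>\<mu> n\<bar>"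
        using intf by simp
      also have "\<dots> \<le> (\<integral>s. \<bar>f (X n s) - f q\<bar> \<partial>\<mu> n)" by (rule integral_abs_bound)
      also have "\<dots> \<le> (\<integral>s. r / 2 + 2 * C / \<delta> * norm (X n s - q) \<partial>\<mu> n)"
        using intf elim(1) bd by (intro integral_pmf_mono) auto
      also have "\<dots> = r / 2 + 2 * C / \<delta> * (\<integral>s. norm (X n s - q) \<partial>\<mu> n)"
        using elim(1) by simp
      finally show ?case using elim(2) by simp
    qed
    then show "\<exists>N. \<forall>n\<ge>N. norm ((\<integral>s. f (X n s) \<partial>\<mu> n) - f q) < r" by (simp add: eventually_sequentially)
  qed
  then show "(\<lambda>n. integral\<^sup>L (distr (measure_pmf (\<mu> n)) borel (X n)) f) \<longlonglongrightarrow> integral\<^sup>L (return borel q) f"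
    using meas by (simp add: integral_distr integral_return)
qed

lemma coord_occupancy: "coord (occupancy n s) i = occ n (fst s) i"
proof -
  obtain x E where s: "s = (x, E)" by (cases s)
  have "{1..n} \<inter> {u. i \<le> x u} = {u \<in> {1..n}. x u \<ge> i}" by auto
  then show ?thesis unfolding s occ_def by (subst sum_of_bool_eq) (simp_all add: occupancy.rep_eq)
qed

lemma norm_ell1_diff: "norm (x - y) = (\<Sum>i. \<bar>coord x i - coord y i\<bar>)"
  by transfer simp

lemma summable_coord_diff: "summable (\<lambda>i. \<bar>coord x i - coord y i\<bar>)"
  using summable_coord[of "x - y"] by (simp add: minus_ell1.rep_eq)

lemma occ_eq_card: "occ n x i = real (card {u\<in>{1..n}. i \<le> x u}) / real n"
  using coord_occupancy[of n "(x, {})" i] by (simp add: occupancy.rep_eq)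

context load_balancing
begin

lemma nbhd_occ_mean_eq:
  "nbhd_occ_mean n G x i = (\<integral>d. choose_ratio (card {u\<in>{1..n}. i \<le> x u}) n (Suc d) \<partial>outdegree_pmf n G)"
proof -
  have "nbhd_occ_mean n G x i
      = (\<integral>E. (\<Sum>u\<in>{1..n}. of_bool (insert u (E `` {u}) \<subseteq> {u\<in>{1..n}. i \<le> x u})) / real n \<partial>G)"
    unfolding nbhd_occ_mean_def nbhd_occ_def
  proof (intro integral_pmf_cong arg_cong2[where f="(/)"] sum.cong arg_cong[where f=of_bool] refl)
    fix E u assume "E \<in> set_pmf G" "u \<in> {1..n}"
    from neighbourhood_subset[OF this]
    show "(\<forall>w\<in>insert u (E `` {u}). i \<le> x w) \<longleftrightarrow> insert u (E `` {u}) \<subseteq> {u\<in>{1..n}. i \<le> x u}"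
      by blast
  qed
  also have "\<dots> = (\<integral>d. choose_ratio (card {u\<in>{1..n}. i \<le> x u}) n (Suc d) \<partial>outdegree_pmf n G)"
    by (rule permutation_invariant_mean[OF n graph perm]) auto
  finally show ?thesis .
qed

lemma occ_deviation_le:
  assumes "0 \<le> a" "a \<le> l ^ i"
  shows "(\<integral>s. \<bar>occ n (fst s) i - a\<bar> \<partial>\<pi>) \<le> rho ^ i + l ^ i"
proof -
  have "(\<integral>s. \<bar>occ n (fst s) i - a\<bar> \<partial>\<pi>) \<le> (\<integral>s. occ n (fst s) i + l ^ i \<partial>\<pi>)"
  proof (rule integral_pmf_mono)
    show "\<bar>occ n (fst s) i - a\<bar> \<le> occ n (fst s) i + l ^ i" for s :: state
      using occ_nonneg[of n "fst s" i] assms by linarith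
  qed (use integrable_occ in auto)
  also have "\<dots> \<le> rho ^ i + l ^ i" using integrable_occ occ_decay[of i] by simp
  finally show ?thesis .
qed

end

text \<open>
  The system size tends to infinity first, with the smoothing parameter \<open>\<epsilon>\<close> and the truncation
  level \<open>m\<close> fixed. The boundary term decays geometrically in \<open>m\<close>, but the error from smoothing grows
  linearly in \<open>m\<close>, so \<open>m\<close> is chosen first and \<open>\<epsilon>\<close> depends on it.
\<close>

theorem theorem2:
  fixes lam mu dm :: "nat \<Rightarrow> real"
    and G :: "nat \<Rightarrow> nat rel pmf"
    and D :: "nat \<Rightarrow> dispatch"
    and P :: "nat \<Rightarrow> real \<Rightarrow> state \<Rightarrow> state pmf"
    and \<pi> :: "nat \<Rightarrow> state pmf"
    and lambda :: real and p :: "nat \<Rightarrow> real"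
  assumes "\<And>n. n \<ge> 1 \<Longrightarrow> lam n > 0"
    and "\<And>n. n \<ge> 1 \<Longrightarrow> mu n > 0"
    and "\<And>n E. n \<ge> 1 \<Longrightarrow> E \<in> set_pmf (G n) \<Longrightarrow> simple_digraph n E"
    and "\<And>n. n \<ge> 1 \<Longrightarrow> permutation_invariant n (G n)"
    and "\<And>n. n \<ge> 1 \<Longrightarrow> joins_shortest_queue n (G n) (D n)"
    and "\<And>n. n \<ge> 1 \<Longrightarrow>
           ctmc (state_space n (lam n) (mu n) (G n) (D n))
             (generator n (lam n) (mu n) (G n) (D n)) (P n)"
    and "\<And>n. n \<ge> 1 \<Longrightarrow>
           stationary_distribution (state_space n (lam n) (mu n) (G n) (D n)) (P n) (\<pi> n)"
    and "\<And>n. n \<ge> 1 \<Longrightarrow> dm n \<ge> 0"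
    and "\<And>n. n \<ge> 1 \<Longrightarrow> AE E in measure_pmf (G n). \<forall>v\<in>{1..n}. real (indegree E v) \<le> dm n"
    and "lambda > 0"
    and "\<And>d. p d \<in> {0..1}"
    and "(\<lambda>n. lam n / real n) \<longlonglongrightarrow> lambda"
    and "\<And>d. (\<lambda>n. pmf (outdegree_pmf n (G n)) d) \<longlonglongrightarrow> p d"
    and "(\<lambda>n. (dm n + 1) / mu n) \<longlonglongrightarrow> 0"
    and "p sums 1"
    and "summable (\<lambda>d. real d * p d)"
    and "lambda < 1"
    and "\<And>n. n \<ge> 1 \<Longrightarrow> lam n < real n"
  shows "\<exists>q :: ell1. coord q = qstar lambda p \<and>
           weakly_converges (\<lambda>n. distr (measure_pmf (\<pi> n)) borel (occupancy n)) (return borel q)"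
proof -
  have system: "load_balancing n (lam n) (mu n) (dm n) (G n) (D n) (P n) (\<pi> n)" if "1 \<le> n" for n
    using that assms(1-7) assms(9)[OF that] by unfold_locales (auto simp: AE_measure_pmf_iff)
  have l: "0 \<le> lambda" "lambda \<le> 1" using assms(10,17) by auto
  have p: "0 \<le> p d" for d using assms(11)[of d] by simp
  note phi_p = p assms(15) assms(16)
  note a = qstar_bounds[OF phi_p l]
  define a where "a = qstar lambda p"
  define b where "b x = x * phi p x" for x
  define L where "L = 1 + (\<Sum>d. real d * p d)"
  define rho where "rho n = lam n / real n" for n
  define h where "h n = (dm n + 1) / mu n" for n
  define e where "e n i = (\<integral>s. \<bar>occ n (fst s) i - a i\<bar> \<partial>\<pi> n)" for n i
  have rho: "rho \<longlonglongrightarrow> lambda" and h: "h \<longlonglongrightarrow> 0"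
    using assms(12,14) by (simp_all add: rho_def[abs_def] h_def[abs_def])
  obtain \<kappa> where \<kappa>: "\<kappa> \<longlonglongrightarrow> 0" "\<And>n c. 1 \<le> n \<Longrightarrow> c \<le> n \<Longrightarrow>
      \<bar>(\<integral>d. choose_ratio c n (Suc d) \<partial>outdegree_pmf n (G n)) - (\<Sum>d. (real c / real n) ^ Suc d * p d)\<bar> \<le> \<kappa> n"
    using choose_ratio_uniform_limit[OF p assms(15,13)] by blast
  have step: "e n (Suc k) \<le> lambda * L * e n k + (rho n ^ Suc (Suc m) + lambda ^ Suc (Suc m))
      + (real (Suc m) * (lambda * (L * \<epsilon>) + \<epsilon> + \<bar>rho n - lambda\<bar> + 2 * rho n * \<kappa> n
          + 2 * rho n * ((rho n + 1) * (2 / \<epsilon> + 2) * h n))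
        + (rho n + 1) * (1 / (2 * \<epsilon>)) / real n)"
    if n: "1 \<le> n" and \<epsilon>: "0 < \<epsilon>" and m: "k \<le> m" for n k m \<epsilon>
  proof -
    interpret load_balancing n "lam n" "mu n" "dm n" "G n" "D n" "P n" "\<pi> n" using system[OF n] .
    have kap: "\<bar>nbhd_occ_mean n (G n) x i - b (occ n x i)\<bar> \<le> \<kappa> n" for x i
    proof -
      have "card {u\<in>{1..n}. i \<le> x u} \<le> card {1..n}" by (intro card_mono) auto
      then have "card {u\<in>{1..n}. i \<le> x u} \<le> n" by simp
      from \<kappa>(2)[OF n this] sums_unique[OF times_phi_eq[OF phi_p occ_nonneg occ_le_1, of n x i]]
      show ?thesis unfolding nbhd_occ_mean_eq b_def occ_eq_card by simp
    qed
    have dev: "e n i \<le> rho n ^ i + lambda ^ i" for i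
      unfolding e_def rho_def a_def by (rule occ_deviation_le) (rule a)+
    have "e n (Suc k) \<le> lambda * L * e n k + e n (Suc (Suc m))
      + (real (Suc m) * (lambda * (L * \<epsilon>) + \<epsilon> + \<bar>rho n - lambda\<bar> + 2 * rho n * \<kappa> n
          + 2 * rho n * ((rho n + 1) * (2 / \<epsilon> + 2) * h n))
        + (rho n + 1) * (1 / (2 * \<epsilon>)) / real n)"
      unfolding e_def rho_def h_def
    proof (rule contraction_step[where b=b])
      show "0 \<le> a i" "a i \<le> 1" for i unfolding a_def by (rule a)+
      show "a (Suc i) = lambda * b (a i)" for i unfolding a_def b_def by (rule qstar_Suc[OF phi_p])
      show "0 \<le> b x \<and> b x \<le> 1" if "0 \<le> x" "x \<le> 1" for x
        unfolding b_def using times_phi_bounds[OF phi_p that] by blast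
      show "b x \<le> b y" if "0 \<le> x" "x \<le> y" "y \<le> 1" for x y
        unfolding b_def by (rule times_phi_mono[OF phi_p that])
      show "\<bar>b x - b y\<bar> \<le> L * \<bar>x - y\<bar>" if "0 \<le> x" "x \<le> 1" "0 \<le> y" "y \<le> 1" for x y
        unfolding b_def L_def by (rule times_phi_lipschitz[OF phi_p that])
    qed (rule l kap \<epsilon> m)+
    with dev[of "Suc (Suc m)"] show ?thesis by linarith
  qed
  have e_nonneg: "0 \<le> e n i" for n i unfolding e_def by (rule Bochner_Integration.integral_nonneg) simp
  have coordinate: "(\<lambda>n. e n k) \<longlonglongrightarrow> 0" for k
  proof (induction k)
    case 0
    have "e n 0 = 0" if "1 \<le> n" for n using that by (simp add: e_def a_def occ_def)
    then show ?case by (intro tendsto_eventually) (auto simp: eventually_sequentially)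
  next
    case (Suc k)
    show ?case
    proof (rule LIMSEQ_I)
      fix r :: real assume r: "0 < r"
      have "(\<lambda>m. 2 * lambda ^ m) \<longlonglongrightarrow> 2 * 0"
        using l assms(17) by (intro tendsto_intros LIMSEQ_realpow_zero) auto
      then have "eventually (\<lambda>m. 2 * lambda ^ m < r / 2) sequentially"
        by (rule order_tendstoD) (use r in simp)
      then obtain M where M: "\<And>m. M \<le> m \<Longrightarrow> 2 * lambda ^ m < r / 2"
        by (auto simp: eventually_sequentially)
      \<comment> \<open>the level must exceed \<open>k\<close>, and its tail \<open>2 lambda ^ (m + 2)\<close> must be below \<open>r / 2\<close>\<close>
      define m where "m = max M k"
      have tail: "2 * lambda ^ Suc (Suc m) < r / 2" by (rule M) (simp add: m_def)
      have L: "0 \<le> L" unfolding L_def using p assms(16) by (auto intro!: add_nonneg_nonneg suminf_nonneg)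
      define w where "w = real (Suc m) * (lambda * L + 1)"
      have w: "0 < w" unfolding w_def using l L by (intro mult_pos_pos add_nonneg_pos mult_nonneg_nonneg) auto
      \<comment> \<open>\<open>w\<close> is the factor of \<open>\<epsilon>\<close> in the bound, so smoothing costs \<open>r / 4\<close>\<close>
      define \<epsilon> where "\<epsilon> = r / (4 * w)"
      have \<epsilon>: "0 < \<epsilon>" using r w by (simp add: \<epsilon>_def)
      have w\<epsilon>: "real (Suc m) * (lambda * (L * \<epsilon>) + \<epsilon>) = r / 4"
      proof -
        have "real (Suc m) * (lambda * (L * \<epsilon>) + \<epsilon>) = w * \<epsilon>" by (simp add: w_def algebra_simps)
        then show ?thesis using w by (simp add: \<epsilon>_def)
      qed
      let ?B = "\<lambda>n. lambda * L * e n k + (rho n ^ Suc (Suc m) + lambda ^ Suc (Suc m))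
        + (real (Suc m) * (lambda * (L * \<epsilon>) + \<epsilon> + \<bar>rho n - lambda\<bar> + 2 * rho n * \<kappa> n
            + 2 * rho n * ((rho n + 1) * (2 / \<epsilon> + 2) * h n))
          + (rho n + 1) * (1 / (2 * \<epsilon>)) / real n)"
      have noise: "(\<lambda>n. (rho n + 1) * (1 / (2 * \<epsilon>)) / real n) \<longlonglongrightarrow> 0"
      proof (rule real_tendsto_divide_at_top[OF _ filterlim_real_sequentially])
        show "(\<lambda>n. (rho n + 1) * (1 / (2 * \<epsilon>))) \<longlonglongrightarrow> (lambda + 1) * (1 / (2 * \<epsilon>))"
          by (intro tendsto_mult tendsto_add rho tendsto_const)
      qed
      have "?B \<longlonglongrightarrow> lambda * L * 0 + (lambda ^ Suc (Suc m) + lambda ^ Suc (Suc m))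
        + (real (Suc m) * (lambda * (L * \<epsilon>) + \<epsilon> + \<bar>lambda - lambda\<bar> + 2 * lambda * 0
            + 2 * lambda * ((lambda + 1) * (2 / \<epsilon> + 2) * 0)) + 0)"
        by (intro tendsto_add tendsto_mult tendsto_const tendsto_power tendsto_rabs tendsto_diff
            Suc.IH rho h \<kappa>(1) noise)
      then have "eventually (\<lambda>n. ?B n < r) sequentially"
        by (rule order_tendstoD, insert tail w\<epsilon> r,
            simp only: mult_zero_right diff_self abs_zero add_0_right add_0_left)
      moreover have "eventually (\<lambda>n. 1 \<le> n) sequentially" by (rule eventually_ge_at_top)
      ultimately have "eventually (\<lambda>n. norm (e n (Suc k) - 0) < r) sequentially"
      proof eventually_elim
        case (elim n)
        have "e n (Suc k) \<le> ?B n" by (rule step[OF elim(2) \<epsilon>]) (simp add: m_def)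
        then show ?case using elim(1) e_nonneg[of n "Suc k"] by simp
      qed
      then show "\<exists>N. \<forall>n\<ge>N. norm (e n (Suc k) - 0) < r" by (simp add: eventually_sequentially)
    qed
  qed
  \<comment> \<open>a common ratio \<open>r < 1\<close> for all large \<open>n\<close> makes the tails uniformly summable\<close>
  obtain r where r: "lambda < r" "r < 1" using dense assms(17) by blast
  have "eventually (\<lambda>n. rho n < r) sequentially" using rho r(1) by (rule order_tendstoD)
  then obtain N where N: "\<And>n. N \<le> n \<Longrightarrow> rho n < r" by (auto simp: eventually_sequentially)
  have e_le: "e n i \<le> 2 * r ^ i" if large: "max N 1 \<le> n" for n i
  proof -
    interpret load_balancing n "lam n" "mu n" "dm n" "G n" "D n" "P n" "\<pi> n" using system large by simp
    have "e n i \<le> rho n ^ i + lambda ^ i"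
      unfolding e_def rho_def a_def by (rule occ_deviation_le) (rule a)+
    also have "\<dots> \<le> r ^ i + r ^ i"
    proof (intro add_mono power_mono)
      show "rho n \<le> r" using N[of n] large by simp
      show "0 \<le> rho n" using rho_pos unfolding rho_def by (rule less_imp_le)
    qed (use r l in auto)
    finally show ?thesis by simp
  qed
  have geo: "summable (\<lambda>i. 2 * r ^ i)" using r l by (intro summable_mult summable_geometric) auto
  have total: "(\<lambda>n. \<Sum>i. e n i) \<longlonglongrightarrow> 0"
  proof -
    have "((\<lambda>n. \<Sum>i. e n i) \<longlongrightarrow> (\<Sum>i. 0 :: real)) sequentially"
    proof (rule conjunct2[OF conjunct2[OF tannerys_theorem]])
      show "eventually (\<lambda>(i, n). norm (e n i) \<le> 2 * r ^ i) (at_top \<times>\<^sub>F sequentially)"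
        using e_le e_nonneg by (auto simp: eventually_prod_sequentially intro!: exI[of _ "max N 1"])
    qed (use coordinate geo in auto)
    then show ?thesis by simp
  qed
  have "summable (\<lambda>i. \<bar>a i\<bar>)"
    using a l assms(17) unfolding a_def
    by (intro summable_comparison_test'[OF summable_geometric[of lambda], of 0]) auto
  then obtain q where q: "coord q = a" using Abs_ell1_inverse[of a] by auto
  have norm_eq: "norm (occupancy n s - q) = (\<Sum>i. \<bar>occ n (fst s) i - a i\<bar>)" for n s
    by (simp add: norm_ell1_diff q coord_occupancy)
  have int: "integrable (\<pi> n) (\<lambda>s. norm (occupancy n s - q))"
    and integral: "(\<integral>s. norm (occupancy n s - q) \<partial>\<pi> n) = (\<Sum>i. e n i)" if n: "max N 1 \<le> n" for n
  proof -
    have 1: "integrable (\<pi> n) (\<lambda>s. \<bar>occ n (fst s) i - a i\<bar>)" for i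
    proof (rule integrable_pmf_bounded[of _ _ 1])
      show "\<bar>\<bar>occ n (fst s) i - a i\<bar>\<bar> \<le> 1" for s :: state
        using occ_nonneg[of n "fst s" i] occ_le_1[of n "fst s" i] a(1,3)[of i] unfolding a_def by linarith
    qed
    have 2: "summable (\<lambda>i. norm \<bar>occ n (fst s) i - a i\<bar>)" for s :: state
      using summable_coord_diff[of "occupancy n s" q] by (simp add: q coord_occupancy)
    have 3: "summable (\<lambda>i. \<integral>s. norm \<bar>occ n (fst s) i - a i\<bar> \<partial>\<pi> n)"
      using e_le[OF n] e_nonneg[of n]
      by (intro summable_comparison_test'[OF geo, of 0]) (simp add: e_def)
    show "integrable (\<pi> n) (\<lambda>s. norm (occupancy n s - q))"
      unfolding norm_eq by (intro integrable_suminf 1 3) (simp add: 2[simplified])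
    show "(\<integral>s. norm (occupancy n s - q) \<partial>\<pi> n) = (\<Sum>i. e n i)"
      unfolding norm_eq e_def by (intro integral_suminf 1 3) (simp add: 2[simplified])
  qed
  have "(\<lambda>n. \<integral>s. norm (occupancy n s - q) \<partial>\<pi> n) \<longlonglongrightarrow> 0"
  proof (rule Lim_transform_eventually[OF total])
    show "eventually (\<lambda>n. (\<Sum>i. e n i) = (\<integral>s. norm (occupancy n s - q) \<partial>\<pi> n)) sequentially"
      unfolding eventually_sequentially using integral by metis
  qed
  moreover have "eventually (\<lambda>n. integrable (\<pi> n) (\<lambda>s. norm (occupancy n s - q))) sequentially"
    unfolding eventually_sequentially using int by blast
  ultimately have "weakly_converges (\<lambda>n. distr (measure_pmf (\<pi> n)) borel (occupancy n)) (return borel q)"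
    by (intro weakly_converges_return)
  then show ?thesis using q by (auto simp: a_def)
qed

end
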